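(* The random ordered graph $(\mathbf{G},<)$ is a semi-retract of the canonically ordered atomless Boolean algebra $(\mathbf{B},<)$. Moreover, the functions witnessing this can be chosen to be order-preserving: there exist functions $\phi\colon G\to B$ and $\psi\colon B\to G$, both strictly increasing with respect to the respective linear orders $<$, such that $\phi$ respects quantifier-free types from $(\mathbf{G},<)$ to $(\mathbf{B},<)$, $\psi$ respects quantifier-free types from $(\mathbf{B},<)$ to $(\mathbf{G},<)$, and $\psi\circ\phi$ acts as the identity on the quantifier-free types of $(\mathbf{G},<)$.
   Context: Boolean algebras are considered in the signature $\{\wedge,\vee,\neg,0,1\}$; a Boolean algebra $\mathbf{A}$ carries the partial order $a_1\preceq a_2 \iff a_1\vee a_2=a_2$, and its atoms are the minimal nonzero elements. Every finite Boolean algebra is atomic, so each element is uniquely the join of a set of atoms. Given a finite Boolean algebra and a linear order on its atoms, its natural order is the linear order on the whole algebra obtained by extending the order of atoms anti-lexicographically to these atom-sets: for elements $a\neq b$ with atom sets $S_a,S_b$, $a<b$ iff the largest atom of the symmetric difference $S_a\triangle S_b$ lies in $S_b$. A naturally ordered finite Boolean algebra is a finite Boolean algebra equipped with such an order (in the signature $\{\wedge,\vee,\neg,0,1,<\}$). The class of finite naturally ordered Boolean algebras is a Fraïssé class; its Fraïssé limit (the unique countable homogeneous structure whose age is this class) is the canonically ordered atomless Boolean algebra $(\mathbf{B},<)$, with domain $B$. The random ordered graph $(\mathbf{G},<)=(G;E,<)$ is the Fraïssé limit of the class of all finite simple graphs (edge relation $E$) equipped with a linear order $<$ of the vertices. A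 function $f\colon C\to D$ between the domains of structures $\mathbf{C},\mathbf{D}$ respects (acts on) quantifier-free types if for any two tuples $\bar c_1,\bar c_2$ over $C$ of the same quantifier-free type in $\mathbf{C}$, the tuples $f(\bar c_1),f(\bar c_2)$ (componentwise images) have the same quantifier-free type in $\mathbf{D}$. A structure $\mathbf{C}$ is a semi-retract of $\mathbf{D}$ if there are quantifier-free type respecting functions $\phi\colon C\to D$ and $\psi\colon D\to C$ such that $\psi\circ\phi$ acts as the identity on quantifier-free types of $\mathbf{C}$, i.e. for every tuple $\bar c$ over $C$, $\psi(\phi(\bar c))$ has the same quantifier-free type in $\mathbf{C}$ as $\bar c$. *)

theory Defs
  imports Main "HOL-Library.Countable_Set" "HOL-Library.FuncSet"
begin

text \<open>A language consists of sets of symbols paired with their arities. A structure interprets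
  every symbol on all lists; only lists over the universe whose length is the declared arity matter.
  Universes are allowed to be empty.\<close>

record ('f, 'r) language =
  funs :: "('f \<times> nat) set"
  rels :: "('r \<times> nat) set"

record ('f, 'r, 'a) struct =
  univ :: "'a set"
  interp_fun :: "'f \<Rightarrow> 'a list \<Rightarrow> 'a"
  interp_rel :: "'r \<Rightarrow> 'a list \<Rightarrow> bool"

definition closed_under ::
    "('f, 'r) language \<Rightarrow> ('f, 'r, 'a) struct \<Rightarrow> 'a set \<Rightarrow> bool" where
  "closed_under L M A \<longleftrightarrow> A \<subseteq> univ M \<and>
     (\<forall>(f, n) \<in> funs L. \<forall>xs \<in> lists A. length xs = n \<longrightarrow> interp_fun M f xs \<in> A)"

definition is_structure :: "('f, 'r) language \<Rightarrow> ('f, 'r, 'a) struct \<Rightarrow> bool" where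
  "is_structure L M \<longleftrightarrow> closed_under L M (univ M)"

definition generated ::
    "('f, 'r) language \<Rightarrow> ('f, 'r, 'a) struct \<Rightarrow> 'a set \<Rightarrow> 'a set" where
  "generated L M S = \<Inter>{A. closed_under L M A \<and> S \<subseteq> A}"

definition finitely_generated :: "('f, 'r) language \<Rightarrow> ('f, 'r, 'a) struct \<Rightarrow> bool" where
  "finitely_generated L M \<longleftrightarrow>
     (\<exists>S. finite S \<and> S \<subseteq> univ M \<and> generated L M S = univ M)"

definition restrict_struct ::
    "('f, 'r, 'a) struct \<Rightarrow> 'a set \<Rightarrow> ('f, 'r, 'a) struct" where
  "restrict_struct M A = M\<lparr>univ := A\<rparr>"

definition embedding ::
    "('f, 'r) language \<Rightarrow> ('f, 'r, 'a) struct \<Rightarrow> ('f, 'r, 'b) struct \<Rightarrow> ('a \<Rightarrow> 'b) \<Rightarrow> bool"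
  where
  "embedding L M N h \<longleftrightarrow>
     h \<in> univ M \<rightarrow> univ N \<and> inj_on h (univ M) \<and>
     (\<forall>(f, n) \<in> funs L. \<forall>xs \<in> lists (univ M). length xs = n \<longrightarrow>
        h (interp_fun M f xs) = interp_fun N f (map h xs)) \<and>
     (\<forall>(r, n) \<in> rels L. \<forall>xs \<in> lists (univ M). length xs = n \<longrightarrow>
        interp_rel M r xs = interp_rel N r (map h xs))"

definition isomorphism ::
    "('f, 'r) language \<Rightarrow> ('f, 'r, 'a) struct \<Rightarrow> ('f, 'r, 'b) struct \<Rightarrow> ('a \<Rightarrow> 'b) \<Rightarrow> bool"
  where
  "isomorphism L M N h \<longleftrightarrow> embedding L M N h \<and> h ` univ M = univ N"

definition homogeneous :: "('f, 'r) language \<Rightarrow> ('f, 'r, 'a) struct \<Rightarrow> bool" where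
  "homogeneous L M \<longleftrightarrow>
     (\<forall>A B h. closed_under L M A \<and> finitely_generated L (restrict_struct M A) \<and>
              closed_under L M B \<and> finitely_generated L (restrict_struct M B) \<and>
              isomorphism L (restrict_struct M A) (restrict_struct M B) h \<longrightarrow>
        (\<exists>g. isomorphism L M M g \<and> (\<forall>x \<in> A. g x = h x)))"

text \<open>A finitely generated structure in a countable language is countable, hence isomorphic to
  one whose universe is a set of natural numbers; the age is represented by all such copies.\<close>

definition age ::
    "('f, 'r) language \<Rightarrow> ('f, 'r, 'a) struct \<Rightarrow> ('f, 'r, nat) struct set" where
  "age L M = {A. is_structure L A \<and> finitely_generated L A \<and> (\<exists>h. embedding L A M h)}"

definition fraisse_limit ::
    "('f, 'r) language \<Rightarrow> ('f, 'r, nat) struct set \<Rightarrow> ('f, 'r, 'a) struct \<Rightarrow> bool" where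
  "fraisse_limit L K M \<longleftrightarrow>
     is_structure L M \<and> countable (univ M) \<and> homogeneous L M \<and> age L M = K"

datatype 'f fo_term = Var nat | App 'f "'f fo_term list"

datatype ('f, 'r) qf_formula =
    Falsum
  | Equal "'f fo_term" "'f fo_term"
  | Rel 'r "'f fo_term list"
  | Neg "('f, 'r) qf_formula"
  | Conj "('f, 'r) qf_formula" "('f, 'r) qf_formula"
  | Disj "('f, 'r) qf_formula" "('f, 'r) qf_formula"

text \<open>The number \<open>n\<close> bounds the variables: only \<open>Var 0\<close> to \<open>Var (n - 1)\<close> may occur.\<close>

fun wf_term :: "('f, 'r) language \<Rightarrow> nat \<Rightarrow> 'f fo_term \<Rightarrow> bool" where
  "wf_term L n (Var i) \<longleftrightarrow> i < n"
| "wf_term L n (App f ts) \<longleftrightarrow> (f, length ts) \<in> funs L \<and> (\<forall>t \<in> set ts. wf_term L n t)"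

fun wf_formula :: "('f, 'r) language \<Rightarrow> nat \<Rightarrow> ('f, 'r) qf_formula \<Rightarrow> bool" where
  "wf_formula L n Falsum \<longleftrightarrow> True"
| "wf_formula L n (Equal s t) \<longleftrightarrow> wf_term L n s \<and> wf_term L n t"
| "wf_formula L n (Rel r ts) \<longleftrightarrow> (r, length ts) \<in> rels L \<and> (\<forall>t \<in> set ts. wf_term L n t)"
| "wf_formula L n (Neg p) \<longleftrightarrow> wf_formula L n p"
| "wf_formula L n (Conj p q) \<longleftrightarrow> wf_formula L n p \<and> wf_formula L n q"
| "wf_formula L n (Disj p q) \<longleftrightarrow> wf_formula L n p \<and> wf_formula L n q"

fun eval_term :: "('f, 'r, 'a) struct \<Rightarrow> 'a list \<Rightarrow> 'f fo_term \<Rightarrow> 'a" where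
  "eval_term M xs (Var i) = xs ! i"
| "eval_term M xs (App f ts) = interp_fun M f (map (eval_term M xs) ts)"

fun satisfies :: "('f, 'r, 'a) struct \<Rightarrow> 'a list \<Rightarrow> ('f, 'r) qf_formula \<Rightarrow> bool" where
  "satisfies M xs Falsum \<longleftrightarrow> False"
| "satisfies M xs (Equal s t) \<longleftrightarrow> eval_term M xs s = eval_term M xs t"
| "satisfies M xs (Rel r ts) \<longleftrightarrow> interp_rel M r (map (eval_term M xs) ts)"
| "satisfies M xs (Neg p) \<longleftrightarrow> \<not> satisfies M xs p"
| "satisfies M xs (Conj p q) \<longleftrightarrow> satisfies M xs p \<and> satisfies M xs q"
| "satisfies M xs (Disj p q) \<longleftrightarrow> satisfies M xs p \<or> satisfies M xs q"

text \<open>Tuples of different lengths have different types, as \<open>Equal (Var i) (Var i)\<close> belongs to the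
  type of a tuple iff \<open>i\<close> is smaller than its length.\<close>

definition qf_type ::
    "('f, 'r) language \<Rightarrow> ('f, 'r, 'a) struct \<Rightarrow> 'a list \<Rightarrow> ('f, 'r) qf_formula set" where
  "qf_type L M xs = {p. wf_formula L (length xs) p \<and> satisfies M xs p}"

definition respects_qf_types ::
    "('f, 'r) language \<Rightarrow> ('f, 'r, 'a) struct \<Rightarrow> ('g, 's) language \<Rightarrow> ('g, 's, 'b) struct \<Rightarrow>
     ('a \<Rightarrow> 'b) \<Rightarrow> bool" where
  "respects_qf_types L M L' N h \<longleftrightarrow>
     h \<in> univ M \<rightarrow> univ N \<and>
     (\<forall>xs \<in> lists (univ M). \<forall>ys \<in> lists (univ M). qf_type L M xs = qf_type L M ys \<longrightarrow>
        qf_type L' N (map h xs) = qf_type L' N (map h ys))"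

definition semi_retraction ::
    "('f, 'r) language \<Rightarrow> ('f, 'r, 'a) struct \<Rightarrow> ('g, 's) language \<Rightarrow> ('g, 's, 'b) struct \<Rightarrow>
     ('a \<Rightarrow> 'b) \<Rightarrow> ('b \<Rightarrow> 'a) \<Rightarrow> bool" where
  "semi_retraction L M L' N \<phi> \<psi> \<longleftrightarrow>
     respects_qf_types L M L' N \<phi> \<and> respects_qf_types L' N L M \<psi> \<and>
     (\<forall>xs \<in> lists (univ M). qf_type L M (map (\<psi> \<circ> \<phi>) xs) = qf_type L M xs)"

definition semi_retract ::
    "('f, 'r) language \<Rightarrow> ('f, 'r, 'a) struct \<Rightarrow> ('g, 's) language \<Rightarrow> ('g, 's, 'b) struct \<Rightarrow> bool"
  where
  "semi_retract L M L' N \<longleftrightarrow> (\<exists>\<phi> \<psi>. semi_retraction L M L' N \<phi> \<psi>)"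

datatype rel_sym = Edge | Less

abbreviation less_in :: "('f, rel_sym, 'a) struct \<Rightarrow> 'a \<Rightarrow> 'a \<Rightarrow> bool" where
  "less_in M x y \<equiv> interp_rel M Less [x, y]"

definition linearly_ordered :: "('f, rel_sym, 'a) struct \<Rightarrow> bool" where
  "linearly_ordered M \<longleftrightarrow>
     irreflp_on (univ M) (less_in M) \<and> transp_on (univ M) (less_in M) \<and>
     totalp_on (univ M) (less_in M)"

definition strictly_increasing ::
    "('f, rel_sym, 'a) struct \<Rightarrow> ('g, rel_sym, 'b) struct \<Rightarrow> ('a \<Rightarrow> 'b) \<Rightarrow> bool" where
  "strictly_increasing M N h \<longleftrightarrow>
     (\<forall>x \<in> univ M. \<forall>y \<in> univ M. less_in M x y \<longrightarrow> less_in N (h x) (h y))"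

text \<open>The type \<open>unit\<close> is a dummy: there are no function symbols.\<close>

definition ordered_graph_language :: "(unit, rel_sym) language" where
  "ordered_graph_language = \<lparr>funs = {}, rels = {(Edge, 2), (Less, 2)}\<rparr>"

definition finite_ordered_graph :: "(unit, rel_sym, 'a) struct \<Rightarrow> bool" where
  "finite_ordered_graph M \<longleftrightarrow>
     finite (univ M) \<and>
     irreflp_on (univ M) (\<lambda>x y. interp_rel M Edge [x, y]) \<and>
     symp_on (univ M) (\<lambda>x y. interp_rel M Edge [x, y]) \<and>
     linearly_ordered M"

definition random_ordered_graph :: "(unit, rel_sym, 'a) struct \<Rightarrow> bool" where
  "random_ordered_graph M \<longleftrightarrow>
     fraisse_limit ordered_graph_language (Collect finite_ordered_graph) M"

datatype ba_sym = Meet | Join | Compl | Zero | One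

definition ordered_ba_language :: "(ba_sym, rel_sym) language" where
  "ordered_ba_language =
     \<lparr>funs = {(Meet, 2), (Join, 2), (Compl, 1), (Zero, 0), (One, 0)}, rels = {(Less, 2)}\<rparr>"

abbreviation meet :: "(ba_sym, 'r, 'a) struct \<Rightarrow> 'a \<Rightarrow> 'a \<Rightarrow> 'a" where
  "meet M x y \<equiv> interp_fun M Meet [x, y]"
abbreviation join :: "(ba_sym, 'r, 'a) struct \<Rightarrow> 'a \<Rightarrow> 'a \<Rightarrow> 'a" where
  "join M x y \<equiv> interp_fun M Join [x, y]"
abbreviation compl :: "(ba_sym, 'r, 'a) struct \<Rightarrow> 'a \<Rightarrow> 'a" where
  "compl M x \<equiv> interp_fun M Compl [x]"
abbreviation zero :: "(ba_sym, 'r, 'a) struct \<Rightarrow> 'a" where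
  "zero M \<equiv> interp_fun M Zero []"
abbreviation one :: "(ba_sym, 'r, 'a) struct \<Rightarrow> 'a" where
  "one M \<equiv> interp_fun M One []"

text \<open>The one-element algebra is excluded: it embeds into no other Boolean algebra, so with it the
  finite algebras would not have the joint embedding property.\<close>

definition is_boolean_algebra :: "(ba_sym, rel_sym, 'a) struct \<Rightarrow> bool" where
  "is_boolean_algebra M \<longleftrightarrow>
     is_structure ordered_ba_language M \<and> zero M \<noteq> one M \<and>
     (\<forall>x \<in> univ M. \<forall>y \<in> univ M. \<forall>z \<in> univ M.
        meet M x y = meet M y x \<and> join M x y = join M y x \<and>
        meet M x (meet M y z) = meet M (meet M x y) z \<and>
        join M x (join M y z) = join M (join M x y) z \<and>
        meet M x (join M x y) = x \<and> join M x (meet M x y) = x \<and>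
        meet M x (join M y z) = join M (meet M x y) (meet M x z) \<and>
        join M x (meet M y z) = meet M (join M x y) (join M x z) \<and>
        meet M x (one M) = x \<and> join M x (zero M) = x \<and>
        meet M x (compl M x) = zero M \<and> join M x (compl M x) = one M)"

definition ba_le :: "(ba_sym, 'r, 'a) struct \<Rightarrow> 'a \<Rightarrow> 'a \<Rightarrow> bool" where
  "ba_le M x y \<longleftrightarrow> join M x y = y"

definition atoms :: "(ba_sym, 'r, 'a) struct \<Rightarrow> 'a set" where
  "atoms M = {a \<in> univ M. a \<noteq> zero M \<and>
     (\<forall>x \<in> univ M. ba_le M x a \<and> x \<noteq> zero M \<longrightarrow> x = a)}"

definition atoms_below :: "(ba_sym, 'r, 'a) struct \<Rightarrow> 'a \<Rightarrow> 'a set" where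
  "atoms_below M x = {a \<in> atoms M. ba_le M a x}"

text \<open>The order of the atoms is the reflexive relation \<open>r\<close>; the witness \<open>m\<close> is the \<open>r\<close>-largest
  element of the symmetric difference of the two sets of atoms.\<close>

definition finite_naturally_ordered_ba :: "(ba_sym, rel_sym, 'a) struct \<Rightarrow> bool" where
  "finite_naturally_ordered_ba M \<longleftrightarrow>
     finite (univ M) \<and> is_boolean_algebra M \<and>
     (\<exists>r. linear_order_on (atoms M) r \<and>
        (\<forall>x \<in> univ M. \<forall>y \<in> univ M. less_in M x y \<longleftrightarrow> x \<noteq> y \<and>
           (\<exists>m \<in> atoms_below M y - atoms_below M x.
              \<forall>a \<in> (atoms_below M x - atoms_below M y) \<union> (atoms_below M y - atoms_below M x).
                (a, m) \<in> r)))"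

definition ordered_atomless_ba :: "(ba_sym, rel_sym, 'a) struct \<Rightarrow> bool" where
  "ordered_atomless_ba M \<longleftrightarrow>
     fraisse_limit ordered_ba_language (Collect finite_naturally_ordered_ba) M"

end

theory Submission
  imports Defs
begin

text \<open>Send a vertex \<open>x\<close> of the random ordered graph to the set of finite cliques that contain \<open>x\<close>. Two such
  sets meet iff the vertices are adjacent, so the graph can be read off from the meets. Order the
  cliques so that a clique lies above its supersets and the singletons are ordered like the vertices.
  Every nonempty set of cliques that depends only on the intersection with a finite set of vertices
  then has a largest element, so these sets form a countable Boolean algebra that is naturally ordered
  on each finite subalgebra (an atom is placed according to its largest clique). By universality it
  embeds into \<open>B\<close>, which gives \<open>\<phi>\<close>. As the algebra is defined from the graph
  without choices, automorphisms of the graph act on it, and homogeneity of the graph shows that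
  \<open>\<phi>\<close> respects types. Conversely, \<open>B\<close> with the edges \<open>x \<and> y \<noteq> 0\<close> is a countable
  ordered graph, and \<open>\<psi>\<close> embeds it into \<open>G\<close>.\<close>

section \<open>Substructures and embeddings\<close>

text \<open>Over a finite set \<open>F\<close> of vertices the clique algebra has one atom for each
  clique inside \<open>F\<close>, namely the cliques with that trace on \<open>F\<close>. So it is
  the freest algebra generated by the vertices in which distinct nonadjacent vertices are disjoint.

  The obstacle is the order. Enlarging \<open>F\<close> splits atoms, and the natural order of the
  finer algebra has to restrict to that of the coarser one. This works if the largest clique of an
  atom is its trace on \<open>F\<close>, which survives every further splitting; so deleting
  vertices must move a clique up. At the same time the singletons have to keep the order of the
  vertices, or \<open>\<phi>\<close> would not be increasing. The double reversal in
  \<open>clique_order\<close> achieves both.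

  The embedding of the clique algebra into \<open>B\<close> may be arbitrary: embeddings preserve
  quantifier-free types, so invariance under automorphisms is needed only inside the clique algebra.
  Finally, \<open>\<phi>\<close> turns out to be an embedding of \<open>G\<close> into the graph on
  \<open>B\<close>; hence \<open>\<psi> \<circ> \<phi>\<close> embeds \<open>G\<close> into itself
  and preserves its types.\<close>

lemma restrict_simps [simp]:
  "univ (restrict_struct M A) = A"
  "interp_fun (restrict_struct M A) = interp_fun M"
  "interp_rel (restrict_struct M A) = interp_rel M"
  by (simp_all add: restrict_struct_def)

lemma restrict_univ [simp]: "restrict_struct M (univ M) = M"
  by (simp add: restrict_struct_def)

lemma closed_underI:
  assumes "A \<subseteq> univ M"
    and "\<And>f xs. (f, length xs) \<in> funs L \<Longrightarrow> xs \<in> lists A \<Longrightarrow> interp_fun M f xs \<in> A"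
  shows "closed_under L M A"
  using assms by (auto simp: closed_under_def)

lemma closed_under_subset: "closed_under L M A \<Longrightarrow> A \<subseteq> univ M"
  by (simp add: closed_under_def)

lemma closed_underD:
  "closed_under L M A \<Longrightarrow> (f, length xs) \<in> funs L \<Longrightarrow> xs \<in> lists A \<Longrightarrow> interp_fun M f xs \<in> A"
  by (auto simp: closed_under_def)

lemma closed_under_restrict:
  "A \<subseteq> univ M \<Longrightarrow> closed_under L (restrict_struct M A) C \<longleftrightarrow> C \<subseteq> A \<and> closed_under L M C"
  by (auto simp: closed_under_def)

lemma is_structure_restrict: "closed_under L M A \<Longrightarrow> is_structure L (restrict_struct M A)"
  by (auto simp: is_structure_def closed_under_def)

lemma closed_under_generated:
  assumes "is_structure L M" "S \<subseteq> univ M"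
  shows "closed_under L M (generated L M S)"
proof (rule closed_underI)
  show "generated L M S \<subseteq> univ M"
    using assms by (auto simp: generated_def is_structure_def)
next
  fix f xs assume f: "(f, length xs) \<in> funs L" and xs: "xs \<in> lists (generated L M S)"
  show "interp_fun M f xs \<in> generated L M S"
    unfolding generated_def
  proof (rule InterI)
    fix C assume "C \<in> {A. closed_under L M A \<and> S \<subseteq> A}"
    moreover from this xs have "xs \<in> lists C"
      unfolding generated_def by (auto simp: in_lists_conv_set)
    ultimately show "interp_fun M f xs \<in> C"
      using f closed_underD by fastforce
  qed
qed

lemma subset_generated: "S \<subseteq> generated L M S"
  by (auto simp: generated_def)

lemma generated_minimal: "closed_under L M A \<Longrightarrow> S \<subseteq> A \<Longrightarrow> generated L M S \<subseteq> A"
  by (auto simp: generated_def)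

lemma generated_mono: "S \<subseteq> T \<Longrightarrow> generated L M S \<subseteq> generated L M T"
  by (auto simp: generated_def)

lemma finitely_generated_restrict:
  assumes "is_structure L M" "finite S" "S \<subseteq> univ M"
  shows "finitely_generated L (restrict_struct M (generated L M S))"
proof -
  let ?A = "generated L M S"
  have cl: "closed_under L M ?A" using assms by (simp add: closed_under_generated)
  have "generated L (restrict_struct M ?A) S = ?A"
  proof
    show "generated L (restrict_struct M ?A) S \<subseteq> ?A"
      by (rule generated_minimal)
         (use cl in \<open>auto simp: closed_under_restrict closed_under_subset subset_generated\<close>)
    show "?A \<subseteq> generated L (restrict_struct M ?A) S"
      using cl unfolding generated_def[of L "restrict_struct M ?A"]
      by (auto simp: closed_under_restrict closed_under_subset dest: generated_minimal)
  qed
  then show ?thesis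
    using assms subset_generated unfolding finitely_generated_def by fastforce
qed

lemma embeddingI:
  assumes "\<And>x. x \<in> univ M \<Longrightarrow> h x \<in> univ N" "inj_on h (univ M)"
    and "\<And>f xs. (f, length xs) \<in> funs L \<Longrightarrow> xs \<in> lists (univ M) \<Longrightarrow>
      h (interp_fun M f xs) = interp_fun N f (map h xs)"
    and "\<And>r xs. (r, length xs) \<in> rels L \<Longrightarrow> xs \<in> lists (univ M) \<Longrightarrow>
      interp_rel M r xs = interp_rel N r (map h xs)"
  shows "embedding L M N h"
proof -
  have "\<forall>(f, n) \<in> funs L. \<forall>xs \<in> lists (univ M). length xs = n \<longrightarrow>
      h (interp_fun M f xs) = interp_fun N f (map h xs)"
    and "\<forall>(r, n) \<in> rels L. \<forall>xs \<in> lists (univ M). length xs = n \<longrightarrow>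
      interp_rel M r xs = interp_rel N r (map h xs)"
    using assms(3,4) by blast+
  then show ?thesis
    using assms(1,2) by (simp add: embedding_def)
qed

lemma embeddingD:
  assumes "embedding L M N h"
  shows "x \<in> univ M \<Longrightarrow> h x \<in> univ N" "inj_on h (univ M)"
    and "(f, length xs) \<in> funs L \<Longrightarrow> xs \<in> lists (univ M) \<Longrightarrow>
      h (interp_fun M f xs) = interp_fun N f (map h xs)"
    and "(r, length xs) \<in> rels L \<Longrightarrow> xs \<in> lists (univ M) \<Longrightarrow>
      interp_rel M r xs = interp_rel N r (map h xs)"
  using assms by (auto simp: embedding_def)

lemma embedding_comp:
  assumes h: "embedding L M N h" and g: "embedding L N P g"
  shows "embedding L M P (g \<circ> h)"
proof (rule embeddingI)
  show "inj_on (g \<circ> h) (univ M)"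
    using embeddingD(1,2)[OF h] embeddingD(2)[OF g]
    by (intro comp_inj_on) (auto intro: inj_on_subset)
next
  have l: "map h xs \<in> lists (univ N)" if "xs \<in> lists (univ M)" for xs
    using that embeddingD(1)[OF h] by auto
  fix f xs assume "(f, length xs) \<in> funs L" "xs \<in> lists (univ M)"
  then show "(g \<circ> h) (interp_fun M f xs) = interp_fun P f (map (g \<circ> h) xs)"
    using embeddingD(3)[OF h] embeddingD(3)[OF g, of f "map h xs"] l by simp
next
  have l: "map h xs \<in> lists (univ N)" if "xs \<in> lists (univ M)" for xs
    using that embeddingD(1)[OF h] by auto
  fix r xs assume "(r, length xs) \<in> rels L" "xs \<in> lists (univ M)"
  then show "interp_rel M r xs = interp_rel P r (map (g \<circ> h) xs)"
    using embeddingD(4)[OF h] embeddingD(4)[OF g, of r "map h xs"] l by simp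
qed (use embeddingD(1)[OF h] embeddingD(1)[OF g] in auto)

lemma embedding_restrict_dom:
  assumes h: "embedding L M N h" and A: "A \<subseteq> univ M"
  shows "embedding L (restrict_struct M A) N h"
proof (rule embeddingI)
  have l: "xs \<in> lists (univ M)" if "xs \<in> lists (univ (restrict_struct M A))" for xs
    using that A by auto
  show "h (interp_fun (restrict_struct M A) f xs) = interp_fun N f (map h xs)"
    if "(f, length xs) \<in> funs L" "xs \<in> lists (univ (restrict_struct M A))" for f xs
    using embeddingD(3)[OF h that(1) l[OF that(2)]] by simp
  show "interp_rel (restrict_struct M A) r xs = interp_rel N r (map h xs)"
    if "(r, length xs) \<in> rels L" "xs \<in> lists (univ (restrict_struct M A))" for r xs
    using embeddingD(4)[OF h that(1) l[OF that(2)]] by simp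
qed (use embeddingD(1,2)[OF h] A in \<open>auto intro: inj_on_subset\<close>)

lemma embedding_restrict_cod:
  "embedding L M N h \<Longrightarrow> h ` univ M \<subseteq> C \<Longrightarrow> embedding L M (restrict_struct N C) h"
  by (auto simp: embedding_def)

lemma embedding_unrestrict_cod:
  "embedding L M (restrict_struct N C) h \<Longrightarrow> C \<subseteq> univ N \<Longrightarrow> embedding L M N h"
  by (auto simp: embedding_def)

lemma isomorphism_onto_image: "embedding L M N h \<Longrightarrow> isomorphism L M (restrict_struct N (h ` univ M)) h"
  by (auto simp: isomorphism_def embedding_restrict_cod)

lemma isomorphism_comp:
  "isomorphism L M N h \<Longrightarrow> isomorphism L N P g \<Longrightarrow> isomorphism L M P (g \<circ> h)"
  unfolding isomorphism_def using embedding_comp by (metis image_comp)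

lemma closed_under_image:
  assumes h: "embedding L M N h" and A: "closed_under L M A"
  shows "closed_under L N (h ` A)"
proof (rule closed_underI)
  show "h ` A \<subseteq> univ N"
    using embeddingD(1)[OF h] closed_under_subset[OF A] by auto
next
  fix f ys assume f: "(f, length ys) \<in> funs L" and "ys \<in> lists (h ` A)"
  then obtain xs where xs: "xs \<in> lists A" "ys = map h xs"
    by (auto simp: lists_image)
  then have "xs \<in> lists (univ M)"
    using closed_under_subset[OF A] by auto
  then have "interp_fun N f ys = h (interp_fun M f xs)"
    using embeddingD(3)[OF h, of f xs] f xs by simp
  then show "interp_fun N f ys \<in> h ` A"
    using closed_underD[OF A, of f xs] f xs by simp
qed

lemma closed_under_vimage:
  assumes h: "embedding L M N h" and M: "is_structure L M" and C: "closed_under L N C"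
  shows "closed_under L M {x \<in> univ M. h x \<in> C}"
proof (rule closed_underI)
  fix f xs assume f: "(f, length xs) \<in> funs L" and xs: "xs \<in> lists {x \<in> univ M. h x \<in> C}"
  then have xs': "xs \<in> lists (univ M)" "map h xs \<in> lists C"
    by auto
  have "h (interp_fun M f xs) \<in> C"
    using embeddingD(3)[OF h f xs'(1)] closed_underD[OF C, of f "map h xs"] f xs' by simp
  moreover have "interp_fun M f xs \<in> univ M"
    using closed_underD[OF _ f xs'(1)] M by (simp add: is_structure_def)
  ultimately show "interp_fun M f xs \<in> {x \<in> univ M. h x \<in> C}" by simp
qed auto

text \<open>A closed set that contains the images of the generators has a closed preimage that
  contains the generators, and this preimage is everything.\<close>

lemma finitely_generated_image:
  assumes h: "embedding L M N h" and M: "is_structure L M" and fg: "finitely_generated L M"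
  shows "finitely_generated L (restrict_struct N (h ` univ M))"
proof -
  let ?N = "restrict_struct N (h ` univ M)"
  obtain S where S: "finite S" "S \<subseteq> univ M" "generated L M S = univ M"
    using fg by (auto simp: finitely_generated_def)
  have h': "embedding L M ?N h" using embedding_restrict_cod[OF h] by simp
  have "closed_under L ?N (univ ?N)"
    using closed_under_image[OF h'] M by (simp add: is_structure_def)
  then have "generated L ?N (h ` S) \<subseteq> h ` univ M"
    using generated_minimal[of L ?N "h ` univ M" "h ` S"] S(2) by auto
  moreover have "h ` univ M \<subseteq> C" if "closed_under L ?N C" "h ` S \<subseteq> C" for C
    using generated_minimal[OF closed_under_vimage[OF h' M that(1)], of S] S that(2) by auto
  then have "h ` univ M \<subseteq> generated L ?N (h ` S)"
    unfolding generated_def by blast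
  ultimately have "generated L ?N (h ` S) = univ ?N" by simp
  then show ?thesis
    unfolding finitely_generated_def using S by (metis finite_imageI image_mono restrict_simps(1))
qed

lemma isomorphism_inverse:
  assumes h: "isomorphism L M N h" and M: "is_structure L M"
  shows "isomorphism L N M (inv_into (univ M) h)"
proof -
  let ?k = "inv_into (univ M) h"
  have e: "embedding L M N h" and im: "h ` univ M = univ N"
    using h by (auto simp: isomorphism_def)
  have kh: "?k (h x) = x" if "x \<in> univ M" for x
    using embeddingD(2)[OF e] that by simp
  have mk: "map ?k ys \<in> lists (univ M)" "map h (map ?k ys) = ys" if "ys \<in> lists (univ N)" for ys
    using that by (auto simp: im[symmetric] inv_into_into f_inv_into_f in_lists_conv_set intro!: map_idI)
  have "embedding L N M ?k"
  proof (rule embeddingI)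
    fix f ys assume f: "(f, length ys) \<in> funs L" and ys: "ys \<in> lists (univ N)"
    have "h (interp_fun M f (map ?k ys)) = interp_fun N f ys"
      using embeddingD(3)[OF e, of f "map ?k ys"] mk[OF ys] f by simp
    moreover have "interp_fun M f (map ?k ys) \<in> univ M"
      using closed_underD[of L M "univ M" f "map ?k ys"] M f mk(1)[OF ys] by (simp add: is_structure_def)
    ultimately show "?k (interp_fun N f ys) = interp_fun M f (map ?k ys)"
      using kh by metis
  next
    fix r ys assume "(r, length ys) \<in> rels L" and "ys \<in> lists (univ N)"
    then show "interp_rel N r ys = interp_rel M r (map ?k ys)"
      using embeddingD(4)[OF e, of r "map ?k ys"] mk by simp
  qed (auto simp: im[symmetric] inv_into_into inj_on_inv_into)
  moreover have "?k ` univ N = univ M"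
    using kh by (force simp: im[symmetric])
  ultimately show ?thesis by (simp add: isomorphism_def)
qed

section \<open>Countable structures, their copies on the natural numbers, and the age\<close>

lemma nat_copy:
  fixes P :: "('f, 'r, 'a) struct"
  assumes P: "is_structure L P" and cnt: "countable (univ P)"
  obtains A :: "('f, 'r, nat) struct" and k where "is_structure L A" "isomorphism L A P k"
proof -
  define t where "t = to_nat_on (univ P)"
  define k where "k = inv_into (univ P) t"
  define A :: "('f, 'r, nat) struct" where
    "A = \<lparr>univ = t ` univ P, interp_fun = (\<lambda>f xs. t (interp_fun P f (map k xs))),
          interp_rel = (\<lambda>r xs. interp_rel P r (map k xs))\<rparr>"
  have kt: "k (t x) = x" if "x \<in> univ P" for x
    using that cnt by (simp add: k_def t_def inj_on_to_nat_on)
  have mk: "map k xs \<in> lists (univ P)" if "xs \<in> lists (univ A)" for xs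
    using that kt by (fastforce simp: A_def)
  have cl: "interp_fun P f (map k xs) \<in> univ P"
    if "(f, length xs) \<in> funs L" "xs \<in> lists (univ A)" for f xs
    using closed_underD[of L P "univ P" f "map k xs"] P mk that by (simp add: is_structure_def)
  have "is_structure L A"
    unfolding is_structure_def by (rule closed_underI) (use cl in \<open>auto simp: A_def\<close>)
  moreover have "isomorphism L A P k"
    unfolding isomorphism_def
  proof
    show "embedding L A P k"
      by (rule embeddingI) (use cl in \<open>auto simp: A_def kt inj_on_def\<close>)
    show "k ` univ A = univ P"
      by (auto simp: A_def kt image_image)
  qed
  ultimately show ?thesis by (rule that)
qed

text \<open>Members of \<open>age\<close> live on natural numbers, so a substructure generated by a
  finite set enters the age only through a copy.\<close>

lemma age_copy:
  assumes N: "is_structure L N" and cnt: "countable (univ N)" and S: "finite S" "S \<subseteq> univ N"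
  obtains A k where "A \<in> age L N" "isomorphism L A (restrict_struct N (generated L N S)) k"
proof -
  let ?C = "generated L N S"
  have cl: "closed_under L N ?C" using N S by (simp add: closed_under_generated)
  have P: "is_structure L (restrict_struct N ?C)" by (rule is_structure_restrict[OF cl])
  have "countable (univ (restrict_struct N ?C))"
    using countable_subset[OF closed_under_subset[OF cl] cnt] by simp
  then obtain A :: "('a, 'b, nat) struct" and k
    where A: "is_structure L A" and k: "isomorphism L A (restrict_struct N ?C) k"
    using nat_copy[OF P] by blast
  have i: "isomorphism L (restrict_struct N ?C) A (inv_into (univ A) k)"
    by (rule isomorphism_inverse[OF k A])
  then have "finitely_generated L A"
    using finitely_generated_image[OF _ P finitely_generated_restrict[OF N S]]
    by (metis isomorphism_def restrict_univ)
  moreover have "embedding L A N k"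
    using k embedding_unrestrict_cod closed_under_subset[OF cl] by (auto simp: isomorphism_def)
  ultimately have "A \<in> age L N"
    using A by (auto simp: age_def)
  then show ?thesis using k by (rule that)
qed

text \<open>Turns a statement about finitely many elements of the limit into one about a single
  member of \<open>K\<close>; universal axioms pass from \<open>K\<close> to the limit in this
  way.\<close>

lemma fraisse_limit_member:
  assumes M: "fraisse_limit L K M" and S: "finite S" "S \<subseteq> univ M"
  obtains A k where "A \<in> K" "embedding L A M k" "S \<subseteq> k ` univ A"
proof -
  have N: "is_structure L M" "countable (univ M)" "age L M = K"
    using M by (auto simp: fraisse_limit_def)
  obtain A k where A: "A \<in> age L M" and k: "isomorphism L A (restrict_struct M (generated L M S)) k"
    using age_copy[OF N(1,2) S] by blast
  have "embedding L A M k"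
    using k embedding_unrestrict_cod closed_under_subset[OF closed_under_generated[OF N(1) S(2)]]
    by (auto simp: isomorphism_def)
  moreover have "S \<subseteq> k ` univ A"
    using k subset_generated by (fastforce simp: isomorphism_def)
  ultimately show ?thesis using that A N by blast
qed

section \<open>Universality of homogeneous structures\<close>

lemma homogeneousD:
  assumes "homogeneous L M" "closed_under L M A" "finitely_generated L (restrict_struct M A)"
    "closed_under L M B" "finitely_generated L (restrict_struct M B)"
    "isomorphism L (restrict_struct M A) (restrict_struct M B) h"
  shows "\<exists>g. isomorphism L M M g \<and> (\<forall>x \<in> A. g x = h x)"
  using assms(1)[unfolded homogeneous_def, THEN spec[of _ A], THEN spec[of _ B], THEN spec[of _ h]]
    assms(2-)
  by simp

text \<open>The age supplies some embedding \<open>e\<close> of the larger substructure, in general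
  unrelated to \<open>f\<close>. On the smaller one both have finitely generated images, and
  \<open>f\<close> after the inverse of \<open>e\<close> is an isomorphism between these images. An
  automorphism \<open>g\<close> extending it corrects \<open>e\<close> to an extension of
  \<open>f\<close>.\<close>

lemma extend_embedding:
  assumes N: "is_structure L N" "countable (univ N)" and sub: "age L N \<subseteq> age L M"
    and M: "homogeneous L M"
    and S: "finite S" "S \<subseteq> T" and T: "finite T" "T \<subseteq> univ N"
    and f: "embedding L (restrict_struct N (generated L N S)) M f"
  obtains f' where "embedding L (restrict_struct N (generated L N T)) M f'"
    "\<And>x. x \<in> generated L N S \<Longrightarrow> f' x = f x"
proof -
  let ?A = "generated L N S" and ?B = "generated L N T"
  have SN: "S \<subseteq> univ N" using S T by blast
  have clA: "closed_under L N ?A" and clB: "closed_under L N ?B"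
    using N SN T by (auto intro: closed_under_generated)
  have AB: "?A \<subseteq> ?B" by (rule generated_mono[OF S(2)])
  obtain D k where D: "D \<in> age L N" and k: "isomorphism L D (restrict_struct N ?B) k"
    using age_copy[OF N T] by blast
  then obtain e0 where e0: "embedding L D M e0" and sD: "is_structure L D"
    using sub by (auto simp: age_def)
  define e where "e = e0 \<circ> inv_into (univ D) k"
  have e: "embedding L (restrict_struct N ?B) M e"
    unfolding e_def using isomorphism_inverse[OF k sD] e0
    by (auto simp: isomorphism_def intro: embedding_comp)
  let ?NA = "restrict_struct N ?A"
  have sA: "is_structure L ?NA" by (rule is_structure_restrict[OF clA])
  have fgA: "finitely_generated L ?NA" by (rule finitely_generated_restrict[OF N(1) S(1) SN])
  have eA: "embedding L ?NA M e"
    using embedding_restrict_dom[OF e] AB by (simp add: restrict_struct_def)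
  have iso: "isomorphism L (restrict_struct M (e ` ?A)) (restrict_struct M (f ` ?A)) (f \<circ> inv_into ?A e)"
    using isomorphism_comp[OF isomorphism_inverse[OF isomorphism_onto_image[OF eA] sA]
      isomorphism_onto_image[OF f]] by simp
  have "closed_under L M (e ` ?A)" "closed_under L M (f ` ?A)"
    using closed_under_image[OF eA, of ?A] closed_under_image[OF f, of ?A] sA
    by (auto simp: is_structure_def)
  moreover have "finitely_generated L (restrict_struct M (e ` ?A))"
      "finitely_generated L (restrict_struct M (f ` ?A))"
    using finitely_generated_image[OF eA sA fgA] finitely_generated_image[OF f sA fgA] by auto
  ultimately have "\<exists>g. isomorphism L M M g \<and> (\<forall>x \<in> e ` ?A. g x = (f \<circ> inv_into ?A e) x)"
    using homogeneousD[OF M _ _ _ _ iso] by simp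
  then obtain g where g: "isomorphism L M M g"
    and gx: "\<And>x. x \<in> e ` ?A \<Longrightarrow> g x = (f \<circ> inv_into ?A e) x"
    by blast
  show ?thesis
  proof
    show "embedding L (restrict_struct N ?B) M (g \<circ> e)"
      using e g by (auto simp: isomorphism_def intro: embedding_comp)
    fix x assume "x \<in> ?A"
    then show "(g \<circ> e) x = f x"
      using gx[of "e x"] embeddingD(2)[OF eA] by simp
  qed
qed

text \<open>Going forth is enough, since the map need not be onto: \<open>N\<close> is the union of
  the substructures generated by the initial segments of an enumeration, and embeddings of these are
  extended step by step.\<close>

lemma homogeneous_universal:
  assumes N: "is_structure L N" "countable (univ N)" and sub: "age L N \<subseteq> age L M"
    and M: "homogeneous L M"
  obtains h where "embedding L N M h"
proof -
  define S where "S n = {x \<in> univ N. to_nat_on (univ N) x < n}" for n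
  define A where "A n = generated L N (S n)" for n
  have S: "finite (S n)" "S n \<subseteq> univ N" for n
  proof -
    have "inj_on (to_nat_on (univ N)) (S n)"
      by (rule inj_on_subset[OF inj_on_to_nat_on[OF N(2)]]) (auto simp: S_def)
    moreover have "to_nat_on (univ N) ` S n \<subseteq> {..<n}" by (auto simp: S_def)
    ultimately show "finite (S n)" by (meson finite_imageD finite_lessThan finite_subset)
  qed (auto simp: S_def)
  have Smono: "S m \<subseteq> S n" if "m \<le> n" for m n using that by (auto simp: S_def)
  have Amono: "A m \<subseteq> A n" if "m \<le> n" for m n
    unfolding A_def by (rule generated_mono[OF Smono[OF that]])
  have clA: "closed_under L N (A n)" for n
    using N S by (auto simp: A_def intro: closed_under_generated)
  \<comment> \<open>\<open>S 0\<close> is empty, but \<open>A 0\<close> contains the values of any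
    constants, so even the first embedding has to come from the age.\<close>
  obtain D k where D: "D \<in> age L N" and k: "isomorphism L D (restrict_struct N (A 0)) k"
    using age_copy[OF N S, of 0] unfolding A_def by blast
  then obtain e0 where e0: "embedding L D M e0" and sD: "is_structure L D"
    using sub by (auto simp: age_def)
  have base: "\<exists>f. embedding L (restrict_struct N (A 0)) M f"
    using isomorphism_inverse[OF k sD] e0 by (auto simp: isomorphism_def intro: embedding_comp)
  have "\<exists>F. \<forall>n. embedding L (restrict_struct N (A n)) M (F n) \<and> (\<forall>x\<in>A n. F (Suc n) x = F n x)"
  proof (rule dependent_nat_choice, rule base)
    fix f n assume f: "embedding L (restrict_struct N (A n)) M f"
    show "\<exists>f'. embedding L (restrict_struct N (A (Suc n))) M f' \<and> (\<forall>x\<in>A n. f' x = f x)"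
      by (rule extend_embedding[OF N sub M S(1) Smono S, of n "Suc n" f])
         (use f in \<open>auto simp: A_def\<close>)
  qed
  then obtain F where FS:
    "\<forall>n. embedding L (restrict_struct N (A n)) M (F n) \<and> (\<forall>x\<in>A n. F (Suc n) x = F n x)" ..
  have F: "embedding L (restrict_struct N (A n)) M (F n)" for n using FS by simp
  have coh: "F n x = F m x" if "m \<le> n" "x \<in> A m" for m n x
    using that(1)
  proof (induction n rule: dec_induct)
    case (step n)
    then show ?case using FS Amono[of m n] that(2) by auto
  qed simp
  define i where "i x = Suc (to_nat_on (univ N) x)" for x
  have iA: "x \<in> A (i x)" if "x \<in> univ N" for x
    using subset_generated[of "S (i x)"] that by (auto simp: A_def S_def i_def)
  define h where "h x = F (i x) x" for x
  have hF: "h x = F n x" if "x \<in> univ N" "x \<in> A n" for x n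
    using coh[of n "i x" x] coh[of "i x" n x] iA that by (cases "n \<le> i x") (auto simp: h_def)
  have AN: "A n \<subseteq> univ N" for n by (rule closed_under_subset[OF clA])
  \<comment> \<open>Every clause of an embedding concerns one finite list, and an increasing union
    contains such a list in a single stage.\<close>
  have bnd: "\<exists>n. set xs \<subseteq> A n" if "xs \<in> lists (univ N)" for xs
    using that
  proof (induction xs)
    case (Cons x xs)
    then obtain n where "set xs \<subseteq> A n" by auto
    then have "set (x # xs) \<subseteq> A (max n (i x))"
      using Cons iA Amono[of n "max n (i x)"] Amono[of "i x" "max n (i x)"] by auto
    then show ?case by blast
  qed simp
  have mh: "map h xs = map (F n) xs" if "xs \<in> lists (A n)" for xs n
    using that hF subsetD[OF AN] by (auto simp: in_lists_conv_set)
  have "embedding L N M h"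
  proof (rule embeddingI)
    fix x assume "x \<in> univ N"
    then show "h x \<in> univ M" using embeddingD(1)[OF F] iA by (simp add: h_def)
  next
    show "inj_on h (univ N)"
    proof (rule inj_onI)
      fix x y assume xy: "x \<in> univ N" "y \<in> univ N" "h x = h y"
      then obtain n where "x \<in> A n" "y \<in> A n" using bnd[of "[x, y]"] by auto
      then show "x = y" using embeddingD(2)[OF F, of n] hF xy by (auto dest: inj_onD)
    qed
  next
    fix f xs assume f: "(f, length xs) \<in> funs L" and xs: "xs \<in> lists (univ N)"
    then obtain n where n: "xs \<in> lists (A n)" using bnd[of xs] by (auto simp: subset_iff)
    then have "interp_fun N f xs \<in> A n" using closed_underD[OF clA f] by simp
    then show "h (interp_fun N f xs) = interp_fun M f (map h xs)"
      using embeddingD(3)[OF F f] n AN hF mh by (metis restrict_simps(1,2) subsetD)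
  next
    fix r xs assume r: "(r, length xs) \<in> rels L" and xs: "xs \<in> lists (univ N)"
    then obtain n where n: "xs \<in> lists (A n)" using bnd[of xs] by (auto simp: subset_iff)
    then show "interp_rel N r xs = interp_rel M r (map h xs)"
      using embeddingD(4)[OF F r, of n] n by (simp only: mh[OF n] restrict_simps)
  qed
  then show ?thesis by (rule that)
qed

section \<open>Quantifier-free types\<close>

lemma eval_term_embedding:
  assumes "embedding L M N h" "is_structure L M" "xs \<in> lists (univ M)" "wf_term L (length xs) t"
  shows "eval_term M xs t \<in> univ M \<and> eval_term N (map h xs) t = h (eval_term M xs t)"
  using assms(4)
proof (induction t)
  case (Var i)
  then show ?case using assms(3) by (auto simp: in_lists_conv_set)
next
  case (App f ts)
  let ?us = "map (eval_term M xs) ts"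
  have us: "?us \<in> lists (univ M)" "map (eval_term N (map h xs)) ts = map h ?us"
    using App by auto
  have f: "(f, length ?us) \<in> funs L" using App.prems by simp
  have "interp_fun M f ?us \<in> univ M"
    using closed_underD[OF _ f us(1)] assms(2) by (simp add: is_structure_def)
  then show ?case
    using embeddingD(3)[OF assms(1) f us(1)] by (simp only: eval_term.simps us(2))
qed

lemma satisfies_embedding:
  assumes h: "embedding L M N h" and M: "is_structure L M" and xs: "xs \<in> lists (univ M)"
  shows "wf_formula L (length xs) p \<Longrightarrow> satisfies N (map h xs) p \<longleftrightarrow> satisfies M xs p"
proof (induction p)
  case (Equal s t)
  then show ?case
    using eval_term_embedding[OF h M xs, of s] eval_term_embedding[OF h M xs, of t] embeddingD(2)[OF h]
    by (auto dest: inj_onD)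
next
  case (Rel r ts)
  let ?us = "map (eval_term M xs) ts"
  have us: "?us \<in> lists (univ M)" "map (eval_term N (map h xs)) ts = map h ?us"
    using Rel eval_term_embedding[OF h M xs] by auto
  have r: "(r, length ?us) \<in> rels L" using Rel.prems by simp
  show ?case using embeddingD(4)[OF h r us(1)] by (simp only: satisfies.simps us(2))
qed auto

lemma qf_type_embedding:
  assumes "embedding L M N h" "is_structure L M" "xs \<in> lists (univ M)"
  shows "qf_type L N (map h xs) = qf_type L M xs"
  using satisfies_embedding[OF assms] by (auto simp: qf_type_def)

lemma qf_type_length:
  assumes "qf_type L M xs = qf_type L N ys"
  shows "length xs = length ys"
proof -
  have "i < length xs \<longleftrightarrow> i < length ys" for i
  proof -
    have "Equal (Var i) (Var i) \<in> qf_type L M xs \<longleftrightarrow> Equal (Var i) (Var i) \<in> qf_type L N ys"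
      using assms by simp
    then show ?thesis by (simp add: qf_type_def)
  qed
  then show ?thesis by (metis linorder_neqE_nat less_irrefl)
qed

lemma qf_type_satisfies:
  assumes "qf_type L M xs = qf_type L N ys" "wf_formula L (length xs) p"
  shows "satisfies M xs p \<longleftrightarrow> satisfies N ys p"
proof -
  have "p \<in> qf_type L M xs \<longleftrightarrow> p \<in> qf_type L N ys" using assms(1) by simp
  then show ?thesis using assms(2) qf_type_length[OF assms(1)] by (simp add: qf_type_def)
qed

text \<open>Without function symbols every well-formed term is a variable, and both relation symbols
  are binary, so pairs of entries decide every formula.\<close>

lemma ordered_graph_formula_cong:
  assumes "length xs = length ys"
    and "\<And>i j. i < length xs \<Longrightarrow> j < length xs \<Longrightarrow> xs ! i = xs ! j \<longleftrightarrow> ys ! i = ys ! j"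
    and "\<And>R i j. i < length xs \<Longrightarrow> j < length xs \<Longrightarrow>
      interp_rel M R [xs ! i, xs ! j] \<longleftrightarrow> interp_rel N R [ys ! i, ys ! j]"
  shows "wf_formula ordered_graph_language (length xs) p \<Longrightarrow> satisfies M xs p \<longleftrightarrow> satisfies N ys p"
proof (induction p)
  case (Equal s t)
  then obtain i j where "s = Var i" "t = Var j"
    by (cases s; cases t) (auto simp: ordered_graph_language_def)
  then show ?case using Equal assms(2) by auto
next
  case (Rel R ts)
  then obtain s t where ts: "ts = [s, t]"
    by (auto simp: ordered_graph_language_def length_Suc_conv numeral_2_eq_2)
  obtain i j where "s = Var i" "t = Var j"
    using Rel ts by (cases s; cases t) (auto simp: ordered_graph_language_def)
  then show ?case using Rel assms(3) ts by auto
qed auto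

lemma ordered_graph_qf_type_eqI:
  assumes "length xs = length ys"
    and "\<And>i j. i < length xs \<Longrightarrow> j < length xs \<Longrightarrow> xs ! i = xs ! j \<longleftrightarrow> ys ! i = ys ! j"
    and "\<And>R i j. i < length xs \<Longrightarrow> j < length xs \<Longrightarrow>
      interp_rel M R [xs ! i, xs ! j] \<longleftrightarrow> interp_rel N R [ys ! i, ys ! j]"
  shows "qf_type ordered_graph_language M xs = qf_type ordered_graph_language N ys"
  using ordered_graph_formula_cong[OF assms] assms(1) by (auto simp: qf_type_def)

lemma qf_type_eqD:
  assumes "qf_type L M xs = qf_type L N ys" "i < length xs" "j < length xs"
  shows "xs ! i = xs ! j \<longleftrightarrow> ys ! i = ys ! j"
    and "(R, 2) \<in> rels L \<Longrightarrow> interp_rel M R [xs ! i, xs ! j] \<longleftrightarrow> interp_rel N R [ys ! i, ys ! j]"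
  using qf_type_satisfies[OF assms(1), of "Equal (Var i) (Var j)"]
    qf_type_satisfies[OF assms(1), of "Rel R [Var i, Var j]"] assms(2,3) by (auto simp: numeral_2_eq_2)

section \<open>The anti-lexicographic order\<close>

text \<open>The order clause of \<open>finite_naturally_ordered_ba\<close>, isolated because it
  serves at three levels: sets of vertices, of cliques and of atoms. For infinite sets the witness
  \<open>m\<close> may fail to exist.\<close>

definition antilex :: "'a rel \<Rightarrow> 'a set \<Rightarrow> 'a set \<Rightarrow> bool" where
  "antilex r X Y \<longleftrightarrow> (\<exists>m \<in> Y - X. \<forall>a \<in> (X - Y) \<union> (Y - X). (a, m) \<in> r)"

lemma linear_orderD:
  assumes "linear_order_on V r"
  shows "x \<in> V \<Longrightarrow> (x, x) \<in> r" "(x, y) \<in> r \<Longrightarrow> (y, x) \<in> r \<Longrightarrow> x = y"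
    "(x, y) \<in> r \<Longrightarrow> (y, z) \<in> r \<Longrightarrow> (x, z) \<in> r"
    "x \<in> V \<Longrightarrow> y \<in> V \<Longrightarrow> (x, y) \<in> r \<or> (y, x) \<in> r"
    "(x, y) \<in> r \<Longrightarrow> x \<in> V \<and> y \<in> V"
proof -
  have r: "r \<subseteq> V \<times> V" "refl_on V r" "trans r" "antisym r" "total_on V r"
    using assms by (auto simp: order_on_defs)
  show "x \<in> V \<Longrightarrow> (x, x) \<in> r" using r(2) by (simp add: refl_on_def)
  show "(x, y) \<in> r \<Longrightarrow> (y, x) \<in> r \<Longrightarrow> x = y" by (rule antisymD[OF r(4)])
  show "(x, y) \<in> r \<Longrightarrow> (y, z) \<in> r \<Longrightarrow> (x, z) \<in> r" by (rule transD[OF r(3)])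
  show "x \<in> V \<Longrightarrow> y \<in> V \<Longrightarrow> (x, y) \<in> r \<or> (y, x) \<in> r"
    using r(2,5) by (cases "x = y") (auto simp: refl_on_def total_on_def)
  show "(x, y) \<in> r \<Longrightarrow> x \<in> V \<and> y \<in> V" using r(1) by auto
qed

lemma linear_order_greatest:
  assumes "linear_order_on V r" "finite A" "A \<noteq> {}" "A \<subseteq> V"
  shows "\<exists>m \<in> A. \<forall>a \<in> A. (a, m) \<in> r"
  using assms(2-)
proof (induction A rule: finite_ne_induct)
  case (singleton x)
  then show ?case using linear_orderD(1)[OF assms(1)] by simp
next
  case (insert x A)
  then obtain m where m: "m \<in> A" "\<And>a. a \<in> A \<Longrightarrow> (a, m) \<in> r" by auto
  have "x \<in> V" "m \<in> V" using insert m by auto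
  then consider "(x, m) \<in> r" | "(m, x) \<in> r" "(x, x) \<in> r"
    using linear_orderD(1,4)[OF assms(1)] by blast
  then show ?case
  proof cases
    case 1
    then show ?thesis using m by blast
  next
    case 2
    then have "(a, x) \<in> r" if "a \<in> A" for a
      using linear_orderD(3)[OF assms(1) m(2)[OF that]] by blast
    then show ?thesis using 2 by blast
  qed
qed

lemma antilex_irrefl [simp]: "\<not> antilex r X X"
  by (simp add: antilex_def)

lemma antilex_asym:
  assumes "linear_order_on V r" "antilex r X Y"
  shows "\<not> antilex r Y X"
  using assms(2) linear_orderD(2)[OF assms(1)] unfolding antilex_def by (metis DiffD1 DiffD2 UnI1 UnI2)

lemma antilex_total:
  assumes "linear_order_on V r" "finite X" "finite Y" "X \<subseteq> V" "Y \<subseteq> V" "X \<noteq> Y"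
  shows "antilex r X Y \<or> antilex r Y X"
proof -
  obtain m where "m \<in> (X - Y) \<union> (Y - X)" "\<forall>a \<in> (X - Y) \<union> (Y - X). (a, m) \<in> r"
    using linear_order_greatest[OF assms(1), of "(X - Y) \<union> (Y - X)"] assms(2-) by blast
  then show ?thesis unfolding antilex_def by (metis Un_commute Un_iff)
qed

text \<open>The symmetric difference of \<open>X\<close> and \<open>Z\<close> lies in the union of
  the other two, so the larger of the two witnesses bounds it; being the larger is also what puts it
  into \<open>Z\<close> and keeps it out of \<open>X\<close>.\<close>

lemma antilex_trans:
  assumes r: "linear_order_on V r" and "antilex r X Y" "antilex r Y Z"
  shows "antilex r X Z"
proof -
  obtain m where m: "m \<in> Y - X" "\<And>a. a \<in> (X - Y) \<union> (Y - X) \<Longrightarrow> (a, m) \<in> r"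
    using assms(2) by (auto simp: antilex_def)
  obtain k where k: "k \<in> Z - Y" "\<And>a. a \<in> (Y - Z) \<union> (Z - Y) \<Longrightarrow> (a, k) \<in> r"
    using assms(3) by (auto simp: antilex_def)
  have V: "m \<in> V" "k \<in> V" using m(2)[of m] k(2)[of k] m(1) k(1) linear_orderD(5)[OF r] by auto
  show ?thesis
  proof (cases "(m, k) \<in> r")
    case True
    have "k \<notin> X"
      using m k True linear_orderD(2)[OF r, of m k] by auto
    moreover have "(a, k) \<in> r" if "a \<in> (X - Z) \<union> (Z - X)" for a
      using that m(2)[of a] k(2)[of a] True linear_orderD(3)[OF r, of a m k] by blast
    ultimately show ?thesis using k(1) by (auto simp: antilex_def)
  next
    case False
    then have km: "(k, m) \<in> r" using linear_orderD(4)[OF r] V by blast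
    have "m \<in> Z"
      using m k False by auto
    moreover have "(a, m) \<in> r" if "a \<in> (X - Z) \<union> (Z - X)" for a
      using that m(2)[of a] k(2)[of a] km linear_orderD(3)[OF r, of a k m] by blast
    ultimately show ?thesis using m(1) by (auto simp: antilex_def)
  qed
qed

text \<open>Used twice in succession to carry an automorphism of the graph from vertices to cliques
  and from cliques to sets of cliques.\<close>

lemma antilex_image:
  assumes f: "inj_on f V" and X: "X \<subseteq> V" "Y \<subseteq> V"
    and rs: "\<And>a b. a \<in> V \<Longrightarrow> b \<in> V \<Longrightarrow> (f a, f b) \<in> s \<longleftrightarrow> (a, b) \<in> r"
  shows "antilex s (f ` X) (f ` Y) \<longleftrightarrow> antilex r X Y"
proof -
  have d: "f ` X - f ` Y = f ` (X - Y)" "f ` Y - f ` X = f ` (Y - X)"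
    using inj_on_image_set_diff[OF f] X by blast+
  have "(\<forall>a \<in> f ` (X - Y) \<union> f ` (Y - X). (a, f m) \<in> s) \<longleftrightarrow> (\<forall>a \<in> (X - Y) \<union> (Y - X). (a, m) \<in> r)"
    if "m \<in> Y - X" for m
    unfolding image_Un[symmetric] using rs that X by blast
  then show ?thesis
    unfolding antilex_def d by blast
qed

section \<open>Boolean algebras\<close>

lemma ba_closed:
  assumes "is_structure ordered_ba_language M"
  shows "x \<in> univ M \<Longrightarrow> y \<in> univ M \<Longrightarrow> meet M x y \<in> univ M"
    "x \<in> univ M \<Longrightarrow> y \<in> univ M \<Longrightarrow> join M x y \<in> univ M"
    "x \<in> univ M \<Longrightarrow> compl M x \<in> univ M" "zero M \<in> univ M" "one M \<in> univ M"
  using assms[unfolded is_structure_def]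
    closed_underD[of ordered_ba_language M "univ M" Meet "[x, y]"]
    closed_underD[of ordered_ba_language M "univ M" Join "[x, y]"]
    closed_underD[of ordered_ba_language M "univ M" Compl "[x]"]
    closed_underD[of ordered_ba_language M "univ M" Zero "[]"]
    closed_underD[of ordered_ba_language M "univ M" One "[]"]
  by (auto simp: ordered_ba_language_def numeral_2_eq_2)

lemma ba_closed_underI:
  assumes "A \<subseteq> univ M" "\<And>x y. x \<in> A \<Longrightarrow> y \<in> A \<Longrightarrow> meet M x y \<in> A"
    "\<And>x y. x \<in> A \<Longrightarrow> y \<in> A \<Longrightarrow> join M x y \<in> A"
    "\<And>x. x \<in> A \<Longrightarrow> compl M x \<in> A" "zero M \<in> A" "one M \<in> A"
  shows "closed_under ordered_ba_language M A"
proof (rule closed_underI[OF assms(1)])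
  fix f xs assume "(f, length xs) \<in> funs ordered_ba_language" "xs \<in> lists A"
  then show "interp_fun M f xs \<in> A"
    using assms(2-) by (auto simp: ordered_ba_language_def numeral_2_eq_2 length_Suc_conv)
qed

lemma ba_embeddingD:
  assumes "embedding ordered_ba_language M N h"
  shows "x \<in> univ M \<Longrightarrow> y \<in> univ M \<Longrightarrow> h (meet M x y) = meet N (h x) (h y)"
    "x \<in> univ M \<Longrightarrow> y \<in> univ M \<Longrightarrow> h (join M x y) = join N (h x) (h y)"
    "x \<in> univ M \<Longrightarrow> h (compl M x) = compl N (h x)" "h (zero M) = zero N" "h (one M) = one N"
    "x \<in> univ M \<Longrightarrow> y \<in> univ M \<Longrightarrow> less_in M x y \<longleftrightarrow> less_in N (h x) (h y)"
  using embeddingD(3)[OF assms, of Meet "[x, y]"] embeddingD(3)[OF assms, of Join "[x, y]"]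
    embeddingD(3)[OF assms, of Compl "[x]"] embeddingD(3)[OF assms, of Zero "[]"]
    embeddingD(3)[OF assms, of One "[]"] embeddingD(4)[OF assms, of Less "[x, y]"]
  by (auto simp: ordered_ba_language_def numeral_2_eq_2)

lemma ba_embeddingI:
  assumes "\<And>x. x \<in> univ M \<Longrightarrow> h x \<in> univ N" "inj_on h (univ M)"
    "\<And>x y. x \<in> univ M \<Longrightarrow> y \<in> univ M \<Longrightarrow> h (meet M x y) = meet N (h x) (h y)"
    "\<And>x y. x \<in> univ M \<Longrightarrow> y \<in> univ M \<Longrightarrow> h (join M x y) = join N (h x) (h y)"
    "\<And>x. x \<in> univ M \<Longrightarrow> h (compl M x) = compl N (h x)" "h (zero M) = zero N" "h (one M) = one N"
    "\<And>x y. x \<in> univ M \<Longrightarrow> y \<in> univ M \<Longrightarrow> less_in M x y \<longleftrightarrow> less_in N (h x) (h y)"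
  shows "embedding ordered_ba_language M N h"
proof (rule embeddingI[OF assms(1,2)])
  fix f xs assume "(f, length xs) \<in> funs ordered_ba_language" "xs \<in> lists (univ M)"
  then show "h (interp_fun M f xs) = interp_fun N f (map h xs)"
    using assms(3-7) by (auto simp: ordered_ba_language_def numeral_2_eq_2 length_Suc_conv)
next
  fix r xs assume "(r, length xs) \<in> rels ordered_ba_language" "xs \<in> lists (univ M)"
  then show "interp_rel M r xs = interp_rel N r (map h xs)"
    using assms(8) by (auto simp: ordered_ba_language_def numeral_2_eq_2 length_Suc_conv)
qed

context
  fixes M :: "(ba_sym, rel_sym, 'a) struct"
  assumes ba: "is_boolean_algebra M"
begin

lemma ba_structure: "is_structure ordered_ba_language M"
  using ba by (simp add: is_boolean_algebra_def)

lemma ba_axioms: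
  assumes "x \<in> univ M" "y \<in> univ M"
  shows "meet M x y = meet M y x" "join M x y = join M y x"
    "z \<in> univ M \<Longrightarrow> meet M x (meet M y z) = meet M (meet M x y) z"
    "z \<in> univ M \<Longrightarrow> join M x (join M y z) = join M (join M x y) z"
    "meet M x (join M x y) = x" "join M x (meet M x y) = x"
    "z \<in> univ M \<Longrightarrow> meet M x (join M y z) = join M (meet M x y) (meet M x z)"
    "meet M x (one M) = x" "join M x (zero M) = x"
    "meet M x (compl M x) = zero M" "join M x (compl M x) = one M"
  using ba assms unfolding is_boolean_algebra_def by blast+

lemmas ba_cl = ba_closed[OF ba_structure]

lemma ba_le_meet: "x \<in> univ M \<Longrightarrow> y \<in> univ M \<Longrightarrow> ba_le M x y \<longleftrightarrow> meet M x y = x"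
  unfolding ba_le_def using ba_axioms(5)[of x y] ba_axioms(6)[of y x] ba_axioms(1,2)[of x y] by auto

lemma ba_le_trans:
  "x \<in> univ M \<Longrightarrow> y \<in> univ M \<Longrightarrow> z \<in> univ M \<Longrightarrow> ba_le M x y \<Longrightarrow> ba_le M y z \<Longrightarrow> ba_le M x z"
  unfolding ba_le_def using ba_axioms(4)[of x y z] by simp

lemma ba_le_antisym:
  "x \<in> univ M \<Longrightarrow> y \<in> univ M \<Longrightarrow> ba_le M x y \<Longrightarrow> ba_le M y x \<Longrightarrow> x = y"
  unfolding ba_le_def using ba_axioms(2)[of x y] by simp

lemma ba_le_refl: "x \<in> univ M \<Longrightarrow> ba_le M x x"
  using ba_axioms(5)[of x "zero M"] ba_axioms(9)[of x "zero M"] ba_cl ba_le_meet[of x x] by simp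

lemma ba_meet_le:
  assumes "x \<in> univ M" "y \<in> univ M"
  shows "ba_le M (meet M x y) x" "ba_le M (meet M x y) y"
  using ba_axioms(6)[of x y] ba_axioms(6)[of y x] ba_axioms(1)[of x y] ba_axioms(2)[of x "meet M x y"]
    ba_axioms(2)[of y "meet M x y"] ba_cl(1)[of x y] assms
  by (auto simp: ba_le_def)

lemma ba_meet_zero: "x \<in> univ M \<Longrightarrow> meet M x (zero M) = zero M"
  using ba_axioms(5)[of "zero M" x] ba_axioms(1,2)[of "zero M" x] ba_axioms(9)[of x x] ba_cl(4) by simp

lemma exists_atom_le:
  assumes fin: "finite (univ M)" and z: "z \<in> univ M" "z \<noteq> zero M"
  shows "\<exists>a \<in> atoms M. ba_le M a z"
proof -
  let ?A = "{w \<in> univ M. w \<noteq> zero M \<and> ba_le M w z}"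
  let ?R = "\<lambda>x y. ba_le M x y \<and> x \<noteq> y"
  have zA: "z \<in> ?A"
    using z ba_le_refl by simp
  have "\<exists>a \<in> ?A. \<forall>x \<in> ?A. x \<noteq> a \<longrightarrow> \<not> ?R x a"
  proof (rule Finite_Set.bex_min_element)
    show "asymp_on ?A ?R" by (rule asymp_onI) (use ba_le_antisym in auto)
    show "transp_on ?A ?R"
      by (rule transp_onI) (use ba_le_antisym ba_le_trans in blast)
  qed (use fin zA in auto)
  then obtain a where a: "a \<in> ?A" "\<And>x. x \<in> ?A \<Longrightarrow> x \<noteq> a \<Longrightarrow> \<not> ba_le M x a" by blast
  then have "a \<in> atoms M"
    unfolding atoms_def using ba_le_trans[of _ a z] z(1) by auto
  then show ?thesis using a by blast
qed

lemma ba_le_iff_meet_compl: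
  assumes "x \<in> univ M" "y \<in> univ M"
  shows "ba_le M x y \<longleftrightarrow> meet M x (compl M y) = zero M"
proof -
  have "x = join M (meet M x y) (meet M x (compl M y))"
    using ba_axioms(7)[of x y "compl M y"] ba_axioms(8)[of x y] ba_axioms(11)[of y x] ba_cl assms
    by simp
  moreover have "meet M (meet M x y) (compl M y) = zero M"
    using ba_axioms(3)[of x y "compl M y"] ba_axioms(10)[of y x] ba_cl assms ba_meet_zero by simp
  moreover have "join M (meet M x y) (zero M) = meet M x y"
    using ba_axioms(9)[of "meet M x y" x] ba_cl assms by simp
  moreover have "meet M x y = x \<Longrightarrow> meet M x (compl M y) = meet M (meet M x y) (compl M y)"
    by simp
  ultimately show ?thesis
    using ba_le_meet[OF assms] by auto
qed

text \<open>Otherwise some atom lies under the meet of \<open>x\<close> with the complement of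
  \<open>y\<close>; being below \<open>x\<close> it is below \<open>y\<close> too, hence
  zero.\<close>

lemma atoms_below_subsetD:
  assumes fin: "finite (univ M)" and xy: "x \<in> univ M" "y \<in> univ M"
    and sub: "atoms_below M x \<subseteq> atoms_below M y"
  shows "ba_le M x y"
proof (rule ccontr)
  assume "\<not> ba_le M x y"
  then have "meet M x (compl M y) \<noteq> zero M" using ba_le_iff_meet_compl[OF xy] by simp
  moreover have cy: "compl M y \<in> univ M" using xy ba_cl by simp
  moreover have am: "meet M x (compl M y) \<in> univ M" using xy cy ba_cl by simp
  ultimately obtain a where a: "a \<in> atoms M" "ba_le M a (meet M x (compl M y))"
    using exists_atom_le[OF fin am] by blast
  have aM: "a \<in> univ M" "a \<noteq> zero M" using a by (auto simp: atoms_def)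
  have le: "ba_le M a x" "ba_le M a (compl M y)"
    using ba_meet_le[OF xy(1) cy] ba_le_trans[OF aM(1) am _ a(2)] xy cy by simp_all
  then have "ba_le M a y" using sub a by (auto simp: atoms_below_def)
  then have "meet M a (compl M y) = zero M" using ba_le_iff_meet_compl aM xy by simp
  then show False using le(2) ba_le_meet[of a "compl M y"] aM cy by simp
qed

lemma atoms_below_inj:
  assumes "finite (univ M)" "x \<in> univ M" "y \<in> univ M" "atoms_below M x = atoms_below M y"
  shows "x = y"
  using atoms_below_subsetD[OF assms(1), of x y] atoms_below_subsetD[OF assms(1), of y x] assms
  by (intro ba_le_antisym) auto

end

text \<open>The definition asks for a linear order of the atoms only. It extends to all elements
  because an element is determined by its finite set of atoms.\<close>

lemma finite_naturally_ordered_ba_linear: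
  assumes M: "finite_naturally_ordered_ba M"
  shows "linearly_ordered M"
proof -
  have fin: "finite (univ M)" and ba: "is_boolean_algebra M"
    using M by (auto simp: finite_naturally_ordered_ba_def)
  obtain r where r: "linear_order_on (atoms M) r"
    and lt: "\<And>x y. x \<in> univ M \<Longrightarrow> y \<in> univ M \<Longrightarrow>
      less_in M x y \<longleftrightarrow> x \<noteq> y \<and> antilex r (atoms_below M x) (atoms_below M y)"
    using M unfolding finite_naturally_ordered_ba_def antilex_def by blast
  have sub: "atoms_below M x \<subseteq> atoms M" "finite (atoms_below M x)" for x
    using fin by (auto simp: atoms_below_def atoms_def)
  show ?thesis
    unfolding linearly_ordered_def
  proof (intro conjI)
    show "irreflp_on (univ M) (less_in M)"
      by (rule irreflp_onI) (simp add: lt)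
    show "transp_on (univ M) (less_in M)"
    proof (rule transp_onI)
      fix x y z assume xyz: "x \<in> univ M" "y \<in> univ M" "z \<in> univ M" "less_in M x y" "less_in M y z"
      then have "antilex r (atoms_below M x) (atoms_below M z)"
        using antilex_trans[OF r] lt by blast
      then show "less_in M x z" using lt xyz by auto
    qed
    show "totalp_on (univ M) (less_in M)"
    proof (rule totalp_onI)
      fix x y assume xy: "x \<in> univ M" "y \<in> univ M" "x \<noteq> y"
      then have "atoms_below M x \<noteq> atoms_below M y" using atoms_below_inj[OF ba fin] by blast
      then show "less_in M x y \<or> less_in M y x"
        using antilex_total[OF r sub(2) sub(2) sub(1) sub(1)] lt xy by blast
    qed
  qed
qed

section \<open>The algebra of finitely determined sets of cliques\<close>

text \<open>Reflexive, as \<open>linear_order_on\<close> expects, whereas the symbol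
  \<open>Less\<close> is strict.\<close>

definition vertex_order :: "(unit, rel_sym, 'a) struct \<Rightarrow> 'a rel" where
  "vertex_order G = {(x, y). x \<in> univ G \<and> y \<in> univ G \<and> (x = y \<or> less_in G x y)}"

definition cliques :: "(unit, rel_sym, 'a) struct \<Rightarrow> 'a set set" where
  "cliques G = {T. finite T \<and> T \<subseteq> univ G \<and>
     (\<forall>x \<in> T. \<forall>y \<in> T. x \<noteq> y \<longrightarrow> interp_rel G Edge [x, y])}"

text \<open>Reversing both the vertex order and the arguments places every clique above its supersets, and
  keeps the singletons in the order of the vertices.\<close>

definition clique_order :: "(unit, rel_sym, 'a) struct \<Rightarrow> 'a set rel" where
  "clique_order G = {(T, U). T \<in> cliques G \<and> U \<in> cliques G \<and>
     (T = U \<or> antilex ((vertex_order G)\<inverse>) U T)}"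

text \<open>Cylinder sets: for finite \<open>F\<close> they form the algebra generated by the sets
  \<open>cliques_containing G x\<close> with \<open>x\<close> in \<open>F\<close>.\<close>

definition determined :: "(unit, rel_sym, 'a) struct \<Rightarrow> 'a set \<Rightarrow> 'a set set \<Rightarrow> bool" where
  "determined G F S \<longleftrightarrow> S \<subseteq> cliques G \<and> (\<forall>T \<in> cliques G. T \<in> S \<longleftrightarrow> T \<inter> F \<in> S)"

definition clique_algebra ::
    "(unit, rel_sym, 'a) struct \<Rightarrow> (ba_sym, rel_sym, 'a set set) struct" where
  "clique_algebra G = \<lparr>univ = {S. \<exists>F. finite F \<and> F \<subseteq> univ G \<and> determined G F S},
     interp_fun = (\<lambda>f xs. case f of Meet \<Rightarrow> xs ! 0 \<inter> xs ! 1 | Join \<Rightarrow> xs ! 0 \<union> xs ! 1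
       | Compl \<Rightarrow> cliques G - xs ! 0 | Zero \<Rightarrow> {} | One \<Rightarrow> cliques G),
     interp_rel = (\<lambda>_ xs. antilex (clique_order G) (xs ! 0) (xs ! 1))\<rparr>"

definition cliques_containing :: "(unit, rel_sym, 'a) struct \<Rightarrow> 'a \<Rightarrow> 'a set set" where
  "cliques_containing G x = {T \<in> cliques G. x \<in> T}"

lemma clique_algebra_simps [simp]:
  "meet (clique_algebra G) S T = S \<inter> T" "join (clique_algebra G) S T = S \<union> T"
  "compl (clique_algebra G) S = cliques G - S" "zero (clique_algebra G) = {}"
  "one (clique_algebra G) = cliques G"
  "less_in (clique_algebra G) S T = antilex (clique_order G) S T"
  by (simp_all add: clique_algebra_def)

lemma univ_clique_algebra:
  "S \<in> univ (clique_algebra G) \<longleftrightarrow> (\<exists>F. finite F \<and> F \<subseteq> univ G \<and> determined G F S)"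
  by (simp add: clique_algebra_def)

lemma clique_Int: "T \<in> cliques G \<Longrightarrow> T \<inter> F \<in> cliques G"
  by (auto simp: cliques_def)

lemma determined_mono:
  assumes "determined G F S" "F \<subseteq> F'"
  shows "determined G F' S"
proof -
  have "T \<in> S \<longleftrightarrow> T \<inter> F' \<in> S" if "T \<in> cliques G" for T
  proof -
    have "T \<inter> F' \<inter> F = T \<inter> F" using assms(2) by blast
    then show ?thesis
      using assms(1) that clique_Int[OF that, of F'] unfolding determined_def by metis
  qed
  then show ?thesis using assms(1) by (simp add: determined_def)
qed

lemma determined_boolean:
  "determined G F S \<Longrightarrow> determined G F T \<Longrightarrow> determined G F (S \<inter> T)"
  "determined G F S \<Longrightarrow> determined G F T \<Longrightarrow> determined G F (S \<union> T)"
  "determined G F S \<Longrightarrow> determined G F (cliques G - S)"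
  "determined G F {}" "determined G F (cliques G)"
  unfolding determined_def using clique_Int[of _ G F] by (blast | metis Diff_iff Int_iff Un_iff)+

text \<open>A set determined by \<open>F\<close> is recovered from its members inside
  \<open>F\<close>. Both the countability of the clique algebra and the finiteness of its finitely
  generated subalgebras rest on this.\<close>

lemma finite_determined:
  assumes "finite F"
  shows "finite {S. determined G F S}"
proof (rule finite_subset)
  show "{S. determined G F S} \<subseteq> (\<lambda>X. {T \<in> cliques G. T \<inter> F \<in> X}) ` Pow (Pow F)"
  proof
    fix S assume "S \<in> {S. determined G F S}"
    then have "S = {T \<in> cliques G. T \<inter> F \<in> S \<inter> Pow F}"
      by (auto simp: determined_def)
    then show "S \<in> (\<lambda>X. {T \<in> cliques G. T \<inter> F \<in> X}) ` Pow (Pow F)"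
      by blast
  qed
qed (use assms in simp)

lemma common_support:
  assumes "finite A" "A \<subseteq> univ (clique_algebra G)"
  shows "\<exists>F. finite F \<and> F \<subseteq> univ G \<and> (\<forall>S \<in> A. determined G F S)"
  using assms
proof (induction A)
  case (insert S A)
  then obtain F F' where "finite F" "F \<subseteq> univ G" "\<forall>S \<in> A. determined G F S"
    "finite F'" "F' \<subseteq> univ G" "determined G F' S"
    by (auto simp: univ_clique_algebra)
  then show ?case
    by (intro exI[of _ "F \<union> F'"]) (auto intro: determined_mono)
qed auto

lemma clique_algebra_structure: "is_structure ordered_ba_language (clique_algebra G)"
  unfolding is_structure_def
proof (rule ba_closed_underI)
  fix S T assume ST: "S \<in> univ (clique_algebra G)" "T \<in> univ (clique_algebra G)"
  then obtain F where F: "finite F" "F \<subseteq> univ G" "determined G F S" "determined G F T"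
    using common_support[of "{S, T}"] by auto
  show "meet (clique_algebra G) S T \<in> univ (clique_algebra G)"
    "join (clique_algebra G) S T \<in> univ (clique_algebra G)"
    using F determined_boolean[of G F] by (auto simp: univ_clique_algebra)
next
  fix S assume "S \<in> univ (clique_algebra G)"
  then show "compl (clique_algebra G) S \<in> univ (clique_algebra G)"
    using determined_boolean(3)[of G _ S] by (auto simp: univ_clique_algebra)
qed (use determined_boolean(4,5)[of G "{}"] in \<open>auto simp: univ_clique_algebra\<close>)

lemma countable_clique_algebra:
  assumes "countable (univ G)"
  shows "countable (univ (clique_algebra G))"
proof -
  have "univ (clique_algebra G) = (\<Union>F \<in> {F. finite F \<and> F \<subseteq> univ G}. {S. determined G F S})"
    unfolding set_eq_iff univ_clique_algebra by simp
  moreover have "countable \<dots>"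
    by (rule countable_UN[OF countable_Collect_finite_subset[OF assms]])
       (simp add: countable_finite finite_determined)
  ultimately show ?thesis by simp
qed

section \<open>Linear orders on vertices and cliques, and the natural order of finite
  subalgebras\<close>

locale ordered_graph =
  fixes G :: "(unit, rel_sym, 'a) struct"
  assumes edge_irrefl: "irreflp_on (univ G) (\<lambda>x y. interp_rel G Edge [x, y])"
    and edge_sym: "symp_on (univ G) (\<lambda>x y. interp_rel G Edge [x, y])"
    and linear: "linearly_ordered G"
begin

lemma linear_vertex_order: "linear_order_on (univ G) (vertex_order G)"
  using linear
  unfolding linearly_ordered_def vertex_order_def order_on_defs refl_on_def trans_def antisym_def
    total_on_def irreflp_on_def transp_on_def totalp_on_def
  by blast

lemmas linear_vertex_order' = linear_vertex_order[folded linear_order_on_converse[of _ "vertex_order G"]]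

text \<open>Totality holds because cliques are finite: two distinct ones differ in finitely many
  vertices, one of which is the least.\<close>

lemma linear_clique_order: "linear_order_on (cliques G) (clique_order G)"
proof -
  have 1: "antisym (clique_order G)"
    unfolding clique_order_def using antilex_asym[OF linear_vertex_order'] by (auto intro!: antisymI)
  have 2: "trans (clique_order G)"
    unfolding clique_order_def using antilex_trans[OF linear_vertex_order'] by (auto intro!: transI)
  have 3: "total_on (cliques G) (clique_order G)"
    unfolding clique_order_def total_on_def
    using antilex_total[OF linear_vertex_order'] by (auto simp: cliques_def)
  show ?thesis
    using 1 2 3 by (auto simp: order_on_defs refl_on_def clique_order_def)
qed

text \<open>Passing to the trace only deletes vertices, so the least vertex of the difference
  belongs to \<open>T\<close>, and in \<open>clique_order\<close> this makes \<open>T\<close> the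
  smaller of the two.\<close>

lemma clique_le_Int:
  assumes T: "T \<in> cliques G"
  shows "(T, T \<inter> F) \<in> clique_order G"
proof (cases "T - F = {}")
  case True
  then have "T \<inter> F = T" by blast
  then show ?thesis using linear_orderD(1)[OF linear_clique_order T] by simp
next
  case False
  then obtain m where "m \<in> T - F" "\<forall>a \<in> T - F. (a, m) \<in> (vertex_order G)\<inverse>"
    using linear_order_greatest[OF linear_vertex_order', of "T - F"] T by (auto simp: cliques_def)
  then have "antilex ((vertex_order G)\<inverse>) (T \<inter> F) T"
    by (auto simp: antilex_def)
  then show ?thesis using T clique_Int by (auto simp: clique_order_def)
qed

text \<open>The largest clique of a nonempty set determined by \<open>F\<close> is found among the subsets
  of \<open>F\<close>, although the set itself may be infinite.\<close>

lemma determined_greatest: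
  assumes S: "S \<in> univ (clique_algebra G)" "S \<noteq> {}"
  shows "\<exists>m \<in> S. \<forall>T \<in> S. (T, m) \<in> clique_order G"
proof -
  obtain F where F: "finite F" "determined G F S"
    using S by (auto simp: univ_clique_algebra)
  have SF: "T \<inter> F \<in> S \<inter> Pow F" "T \<in> cliques G" if "T \<in> S" for T
    using F that by (auto simp: determined_def)
  then obtain m where m: "m \<in> S \<inter> Pow F" "\<forall>T \<in> S \<inter> Pow F. (T, m) \<in> clique_order G"
    using linear_order_greatest[OF linear_clique_order, of "S \<inter> Pow F"] S F(1) by fastforce
  have "(T, m) \<in> clique_order G" if "T \<in> S" for T
    using linear_orderD(3)[OF linear_clique_order clique_le_Int] SF[OF that] m by blast
  then show ?thesis using m by blast
qed

text \<open>The atoms of \<open>A\<close> correspond to a partition of the cliques into blocks, each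
  with a largest member \<open>top a\<close>. The symmetric difference of two elements is a union of
  blocks, so its largest clique is the top of its largest block when atoms are ordered by
  \<open>top\<close>. The form with an abstract \<open>A\<close> and an embedding fits the copies
  that make up the age.\<close>

lemma finite_naturally_ordered_ba_subalgebra:
  assumes A: "is_structure ordered_ba_language A" and fin: "finite (univ A)"
    and h: "embedding ordered_ba_language A (clique_algebra G) h"
  shows "finite_naturally_ordered_ba A"
proof -
  note cl = ba_closed[OF A]
  note hh = ba_embeddingD[OF h, simplified]
  \<comment> \<open>Identities in \<open>A\<close> can be checked after applying \<open>h\<close>,
    where they become identities between sets of cliques.\<close>
  have inj: "h x = h y \<Longrightarrow> x = y" if "x \<in> univ A" "y \<in> univ A" for x y
    using embeddingD(2)[OF h] that by (auto dest: inj_onD)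
  have hX: "h x \<subseteq> cliques G" if "x \<in> univ A" for x
    using embeddingD(1)[OF h that] by (auto simp: univ_clique_algebra determined_def)
  have X: "{} \<in> cliques G" by (simp add: cliques_def)
  have z: "zero A \<noteq> one A" using hh(4,5) X by auto
  have ba: "is_boolean_algebra A"
    unfolding is_boolean_algebra_def
  proof (intro conjI ballI A z)
    fix x y z assume xyz: "x \<in> univ A" "y \<in> univ A" "z \<in> univ A"
    note u = xyz cl hh hX[OF xyz(1)] hX[OF xyz(2)] hX[OF xyz(3)]
    show "meet A x y = meet A y x" by (rule inj) (use u in auto)
    show "join A x y = join A y x" by (rule inj) (use u in auto)
    show "meet A x (meet A y z) = meet A (meet A x y) z" by (rule inj) (use u in auto)
    show "join A x (join A y z) = join A (join A x y) z" by (rule inj) (use u in auto)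
    show "meet A x (join A x y) = x" by (rule inj) (use u in auto)
    show "join A x (meet A x y) = x" by (rule inj) (use u in auto)
    show "meet A x (join A y z) = join A (meet A x y) (meet A x z)" by (rule inj) (use u in auto)
    show "join A x (meet A y z) = meet A (join A x y) (join A x z)" by (rule inj) (use u in auto)
    show "meet A x (one A) = x" by (rule inj) (use u in auto)
    show "join A x (zero A) = x" by (rule inj) (use u in auto)
    show "meet A x (compl A x) = zero A" by (rule inj) (use u in auto)
    show "join A x (compl A x) = one A" by (rule inj) (use u in auto)
  qed
  have le: "ba_le A x y \<longleftrightarrow> h x \<subseteq> h y" if "x \<in> univ A" "y \<in> univ A" for x y
    using hh(2) inj cl that unfolding ba_le_def by (metis Un_absorb1 subset_Un_eq)
  have atom: "a \<in> univ A" "h a \<noteq> {}" if "a \<in> atoms A" for a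
    using that inj[of a "zero A"] hh(4) cl(4) by (auto simp: atoms_def)
  have atom_cases: "h a \<subseteq> h x" if "a \<in> atoms A" "x \<in> univ A" "h a \<inter> h x \<noteq> {}" for a x
  proof -
    have m: "meet A a x \<in> univ A" "h (meet A a x) = h a \<inter> h x"
      using cl(1) hh(1) that(2) atom(1)[OF that(1)] by simp_all
    have "meet A a x \<noteq> zero A"
      using m(2) that(3) hh(4) by metis
    moreover have "ba_le A (meet A a x) a"
      using le[OF m(1) atom(1)[OF that(1)]] m(2) by simp
    ultimately have "meet A a x = a" using that(1) m(1) by (simp add: atoms_def)
    then show ?thesis using m(2) by auto
  qed
  \<comment> \<open>A minimal \<open>h b\<close> containing \<open>T\<close> comes from an atom: a
    nonzero \<open>x\<close> below \<open>b\<close> with \<open>T\<close> outside \<open>h x\<close>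
    could be subtracted from \<open>b\<close>, leaving a smaller set that still contains
    \<open>T\<close>.\<close>
  have cover: "\<exists>a \<in> atoms A. T \<in> h a" if T: "T \<in> cliques G" for T
  proof -
    let ?S = "h ` {x \<in> univ A. T \<in> h x}"
    have "finite ?S" "?S \<noteq> {}" using fin cl(5) hh(5) T by auto
    then obtain m where m: "m \<in> ?S" "\<forall>b \<in> ?S. b \<subseteq> m \<longrightarrow> m = b"
      using finite_has_minimal[of ?S] by auto
    then obtain b where b: "b \<in> univ A" "T \<in> h b" "m = h b" by auto
    have "b \<in> atoms A"
      unfolding atoms_def
    proof (intro CollectI conjI ballI impI b)
      show "b \<noteq> zero A" using b hh(4) by auto
      fix x assume x: "x \<in> univ A" "ba_le A x b \<and> x \<noteq> zero A"
      then have xb: "h x \<subseteq> h b" using le b by auto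
      have "T \<in> h x"
      proof (rule ccontr)
        assume "T \<notin> h x"
        moreover have d: "meet A b (compl A x) \<in> univ A" "h (meet A b (compl A x)) = h b - h x"
          using b(1) x(1) cl(1,3) hh(1,3) hX[of b] by auto
        ultimately have "h b = h b - h x" using m b by blast
        then have "h x = {}" using xb by blast
        then show False using inj[of x "zero A"] x hh(4) cl(4) by simp
      qed
      then have "h b = h x" using m b x xb by blast
      then show "x = b" using inj b x by simp
    qed
    then show ?thesis using b by blast
  qed
  \<comment> \<open>\<open>h a\<close> may be infinite; that it has a largest clique is
    \<open>determined_greatest\<close>.\<close>
  define top where "top a = (SOME m. m \<in> h a \<and> (\<forall>T \<in> h a. (T, m) \<in> clique_order G))" for a
  have top: "top a \<in> h a" "\<And>T. T \<in> h a \<Longrightarrow> (T, top a) \<in> clique_order G" if "a \<in> atoms A" for a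
    using someI_ex[of "\<lambda>m. m \<in> h a \<and> (\<forall>T \<in> h a. (T, m) \<in> clique_order G)"]
      determined_greatest[of "h a"] embeddingD(1)[OF h] atom[OF that]
    unfolding top_def by blast+
  have top_inj: "a = b" if "a \<in> atoms A" "b \<in> atoms A" "top a = top b" for a b
  proof -
    have "h a \<inter> h b \<noteq> {}" using top(1)[OF that(1)] top(1)[OF that(2)] that(3) by auto
    then have "h a = h b"
      using atom_cases[OF that(1), of b] atom_cases[OF that(2), of a] atom that by blast
    then show ?thesis using inj atom that by blast
  qed
  define r where "r = {(a, b). a \<in> atoms A \<and> b \<in> atoms A \<and> (top a, top b) \<in> clique_order G}"
  have topX: "top a \<in> cliques G" if "a \<in> atoms A" for a
    using top(1)[OF that] hX atom[OF that] by blast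
  have r: "linear_order_on (atoms A) r"
  proof -
    have "refl_on (atoms A) r"
      using linear_orderD(1)[OF linear_clique_order topX] by (auto simp: refl_on_def r_def)
    moreover have "trans r"
      using linear_orderD(3)[OF linear_clique_order] by (auto simp: r_def intro!: transI)
    moreover have "antisym r"
      using linear_orderD(2)[OF linear_clique_order] top_inj by (auto simp: r_def intro!: antisymI)
    moreover have "total_on (atoms A) r"
      using linear_orderD(4)[OF linear_clique_order topX topX] by (auto simp: r_def total_on_def)
    ultimately show ?thesis by (auto simp: order_on_defs r_def)
  qed
  \<comment> \<open>Any single clique of an atom decides whether the atom lies below
    \<open>x\<close>, which matches symmetric differences of atom sets with those of clique
    sets.\<close>
  have below: "a \<in> atoms_below A x \<longleftrightarrow> T \<in> h x"
    if "a \<in> atoms A" "x \<in> univ A" "T \<in> h a" for a x T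
    using that le atom[OF that(1)] atom_cases[OF that(1,2)] by (auto simp: atoms_below_def)
  have ba_sub: "a \<in> atoms A" if "a \<in> atoms_below A x" for a x
    using that by (simp add: atoms_below_def)
  have lt: "antilex (clique_order G) (h x) (h y) \<longleftrightarrow> antilex r (atoms_below A x) (atoms_below A y)"
    if x: "x \<in> univ A" and y: "y \<in> univ A" for x y
  proof
    assume "antilex (clique_order G) (h x) (h y)"
    then obtain T where T: "T \<in> h y - h x"
      and Tmax: "\<And>U. U \<in> (h x - h y) \<union> (h y - h x) \<Longrightarrow> (U, T) \<in> clique_order G"
      by (auto simp: antilex_def)
    then obtain m where m: "m \<in> atoms A" "T \<in> h m" using cover hX y by blast
    have mb: "m \<in> atoms_below A y - atoms_below A x"
      using below[OF m(1) _ m(2)] x y T by blast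
    moreover have "(a, m) \<in> r"
      if a: "a \<in> (atoms_below A x - atoms_below A y) \<union> (atoms_below A y - atoms_below A x)" for a
    proof -
      have aA: "a \<in> atoms A" using a ba_sub by blast
      \<comment> \<open>All of \<open>h a\<close> lies in the symmetric difference, so
        \<open>top a\<close> is at most \<open>T\<close>, and \<open>T\<close> is at most
        \<open>top m\<close> because it lies in \<open>h m\<close>.\<close>
      have "top a \<in> (h x - h y) \<union> (h y - h x)"
        using a below[OF aA x top(1)[OF aA]] below[OF aA y top(1)[OF aA]] by blast
      then have "(top a, top m) \<in> clique_order G"
        using linear_orderD(3)[OF linear_clique_order Tmax top(2)[OF m]] by blast
      then show ?thesis using aA m by (simp add: r_def)
    qed
    ultimately show "antilex r (atoms_below A x) (atoms_below A y)"
      unfolding antilex_def by blast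
  next
    assume "antilex r (atoms_below A x) (atoms_below A y)"
    then obtain m where m: "m \<in> atoms_below A y - atoms_below A x" and mmax:
      "\<And>a. a \<in> (atoms_below A x - atoms_below A y) \<union> (atoms_below A y - atoms_below A x) \<Longrightarrow> (a, m) \<in> r"
      by (auto simp: antilex_def)
    have mA: "m \<in> atoms A" using m ba_sub by blast
    have "top m \<in> h y - h x"
      using m below[OF mA x top(1)[OF mA]] below[OF mA y top(1)[OF mA]] by blast
    moreover have "(T, top m) \<in> clique_order G" if T: "T \<in> (h x - h y) \<union> (h y - h x)" for T
    proof -
      obtain a where a: "a \<in> atoms A" "T \<in> h a" using T cover hX x y by blast
      have "(a, m) \<in> r"
        using mmax[of a] T below[OF a(1) x a(2)] below[OF a(1) y a(2)] by blast
      then show ?thesis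
        using linear_orderD(3)[OF linear_clique_order top(2)[OF a]] by (simp add: r_def)
    qed
    ultimately show "antilex (clique_order G) (h x) (h y)"
      unfolding antilex_def by blast
  qed
  have less: "less_in A x y \<longleftrightarrow> x \<noteq> y \<and> antilex r (atoms_below A x) (atoms_below A y)"
    if "x \<in> univ A" "y \<in> univ A" for x y
    using hh(6) lt that by auto
  show ?thesis
    unfolding finite_naturally_ordered_ba_def
    by (intro conjI fin ba exI[of _ r] r ballI, unfold antilex_def[symmetric]) (rule less)
qed

text \<open>Finite generation must yield finiteness: the generators share a finite support
  \<open>F\<close>, the elements determined by \<open>F\<close> are closed under the operations, and
  there are only finitely many of them.\<close>

lemma age_clique_algebra:
  "age ordered_ba_language (clique_algebra G) \<subseteq> Collect finite_naturally_ordered_ba"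
proof
  fix A :: "(ba_sym, rel_sym, nat) struct"
  assume "A \<in> age ordered_ba_language (clique_algebra G)"
  then obtain h where A: "is_structure ordered_ba_language A"
    and fg: "finitely_generated ordered_ba_language A"
    and h: "embedding ordered_ba_language A (clique_algebra G) h"
    by (auto simp: age_def)
  note hh = ba_embeddingD[OF h, simplified] and cl = ba_closed[OF A]
  obtain S where S: "finite S" "S \<subseteq> univ A" "generated ordered_ba_language A S = univ A"
    using fg by (auto simp: finitely_generated_def)
  have "finite (h ` S)" "h ` S \<subseteq> univ (clique_algebra G)"
    using S embeddingD(1)[OF h] by auto
  from common_support[OF this] obtain F where
    "finite F \<and> F \<subseteq> univ G \<and> (\<forall>T \<in> h ` S. determined G F T)" ..
  then have F: "finite F" "\<And>x. x \<in> S \<Longrightarrow> determined G F (h x)" by simp_all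
  let ?C = "{x \<in> univ A. determined G F (h x)}"
  have "closed_under ordered_ba_language A ?C"
    by (rule ba_closed_underI) (simp_all add: hh cl determined_boolean)
  then have "univ A \<subseteq> ?C"
    using generated_minimal[of ordered_ba_language A ?C S] S F(2) by (simp add: subset_iff)
  then have "h ` univ A \<subseteq> {T. determined G F T}" by auto
  then have "finite (univ A)"
    using finite_determined[OF F(1)] embeddingD(2)[OF h] by (meson finite_imageD finite_subset)
  then show "A \<in> Collect finite_naturally_ordered_ba"
    using finite_naturally_ordered_ba_subalgebra A h by simp
qed

section \<open>Vertices as elements of the clique algebra, and the action of automorphisms\<close>

lemma cliques_containing_in_univ:
  assumes "x \<in> univ G"
  shows "cliques_containing G x \<in> univ (clique_algebra G)"
  unfolding univ_clique_algebra
  by (rule exI[of _ "{x}"])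
     (use assms clique_Int in \<open>auto simp: determined_def cliques_containing_def\<close>)

text \<open>The largest clique containing exactly one of \<open>x\<close> and \<open>y\<close> is
  \<open>{y}\<close>. A clique with \<open>y\<close> lies below its trace \<open>{y}\<close>; a
  clique with \<open>x\<close> but not \<open>y\<close> has a least vertex that is at most
  \<open>x\<close>, hence less than \<open>y\<close>, and a smaller least vertex makes a smaller
  clique.\<close>

lemma cliques_containing_less:
  assumes x: "x \<in> univ G" and y: "y \<in> univ G" and lt: "less_in G x y"
  shows "antilex (clique_order G) (cliques_containing G x) (cliques_containing G y)"
proof -
  let ?r = "vertex_order G"
  have xy: "(x, y) \<in> ?r" using x y lt by (simp add: vertex_order_def)
  have ne: "x \<noteq> y" using linear x lt by (auto simp: linearly_ordered_def irreflp_on_def)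
  have ysing: "{y} \<in> cliques G" using y by (simp add: cliques_def)
  have "(T, {y}) \<in> clique_order G" if T: "T \<in> cliques G" "x \<in> T \<longleftrightarrow> y \<notin> T" for T
  proof (cases "y \<in> T")
    case True
    then have "T \<inter> {y} = {y}" by blast
    then show ?thesis using clique_le_Int[OF T(1), of "{y}"] by simp
  next
    case False
    then have xT: "x \<in> T" using T by simp
    obtain m where m: "m \<in> T" "\<forall>a \<in> T. (a, m) \<in> ?r\<inverse>"
      using linear_order_greatest[OF linear_vertex_order', of T] T xT by (auto simp: cliques_def)
    then have "(m, y) \<in> ?r" using linear_orderD(3)[OF linear_vertex_order _ xy] xT by blast
    then have "antilex (?r\<inverse>) {y} T"
      unfolding antilex_def using m False by auto
    then show ?thesis using T ysing by (simp add: clique_order_def)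
  qed
  then show ?thesis
    unfolding antilex_def
    by (intro bexI[of _ "{y}"]) (use ysing ne in \<open>auto simp: cliques_containing_def\<close>)
qed

lemma cliques_containing_meet:
  assumes "x \<in> univ G" "y \<in> univ G" "x \<noteq> y"
  shows "cliques_containing G x \<inter> cliques_containing G y \<noteq> {} \<longleftrightarrow> interp_rel G Edge [x, y]"
proof
  assume "interp_rel G Edge [x, y]"
  moreover from this have "interp_rel G Edge [y, x]"
    using edge_sym assms by (auto simp: symp_on_def)
  ultimately have "{x, y} \<in> cliques G"
    using assms by (auto simp: cliques_def)
  then show "cliques_containing G x \<inter> cliques_containing G y \<noteq> {}"
    by (auto simp: cliques_containing_def)
qed (use assms in \<open>auto simp: cliques_containing_def cliques_def\<close>)

text \<open>Cliques, supports and both orders are defined from \<open>G\<close> alone, so taking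
  images twice preserves them. The second conclusion says that the action on the algebra extends the
  one on the vertices.\<close>

lemma automorphism_clique_algebra:
  assumes g: "isomorphism ordered_graph_language G G g"
  defines "h \<equiv> (`) ((`) g)"
  shows "embedding ordered_ba_language (clique_algebra G) (clique_algebra G) h"
    and "\<And>x. x \<in> univ G \<Longrightarrow> h (cliques_containing G x) = cliques_containing G (g x)"
proof -
  let ?V = "univ G" and ?X = "cliques G"
  have e: "embedding ordered_graph_language G G g" and surj: "g ` ?V = ?V"
    using g by (auto simp: isomorphism_def)
  have inj: "inj_on g ?V" by (rule embeddingD(2)[OF e])
  have rel: "interp_rel G R [x, y] \<longleftrightarrow> interp_rel G R [g x, g y]" if "x \<in> ?V" "y \<in> ?V" for R x y
    using embeddingD(4)[OF e, of R "[x, y]"] that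
    by (cases R) (auto simp: ordered_graph_language_def numeral_2_eq_2)
  have XV: "?X \<subseteq> Pow ?V" by (auto simp: cliques_def)
  have injP: "inj_on ((`) g) (Pow ?V)" by (rule inj_on_image_Pow[OF inj])
  have injX: "inj_on ((`) g) ?X" by (rule inj_on_subset[OF injP XV])
  \<comment> \<open>An equivalence for arbitrary sets of vertices, so that it also shows in
    \<open>imX\<close> that every clique is the image of a clique.\<close>
  have clq: "g ` T \<in> ?X \<longleftrightarrow> T \<in> ?X" if "T \<subseteq> ?V" for T
  proof -
    have "finite (g ` T) \<longleftrightarrow> finite T"
      using inj_on_subset[OF inj that] by (simp add: finite_image_iff)
    moreover have "g ` T \<subseteq> ?V" using that surj by blast
    moreover have "(\<forall>x \<in> g ` T. \<forall>y \<in> g ` T. x \<noteq> y \<longrightarrow> interp_rel G Edge [x, y]) \<longleftrightarrow>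
        (\<forall>x \<in> T. \<forall>y \<in> T. x \<noteq> y \<longrightarrow> interp_rel G Edge [x, y])"
    proof -
      have "g x = g y \<longleftrightarrow> x = y" "interp_rel G Edge [g x, g y] \<longleftrightarrow> interp_rel G Edge [x, y]"
        if "x \<in> T" "y \<in> T" for x y
        using that \<open>T \<subseteq> ?V\<close> inj rel by (auto simp: inj_on_eq_iff subset_iff)
      then show ?thesis by simp
    qed
    ultimately show ?thesis using that by (simp add: cliques_def)
  qed
  have imX: "(`) g ` ?X = ?X"
  proof
    show "(`) g ` ?X \<subseteq> ?X" using clq XV by auto
    show "?X \<subseteq> (`) g ` ?X"
    proof
      fix T assume T: "T \<in> ?X"
      then obtain U where "U \<subseteq> ?V" "T = g ` U"
        using XV surj by (metis PowD subsetD subset_image_iff)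
      then show "T \<in> (`) g ` ?X" using clq T by blast
    qed
  qed
  have vr: "(g a, g b) \<in> (vertex_order G)\<inverse> \<longleftrightarrow> (a, b) \<in> (vertex_order G)\<inverse>"
    if "a \<in> ?V" "b \<in> ?V" for a b
    using that rel[of b a Less] inj surj by (auto simp: vertex_order_def inj_on_eq_iff)
  have cr: "(g ` T, g ` U) \<in> clique_order G \<longleftrightarrow> (T, U) \<in> clique_order G"
    if "T \<in> ?X" "U \<in> ?X" for T U
  proof -
    have "T \<subseteq> ?V" "U \<subseteq> ?V" using that XV by auto
    then show ?thesis
      using that antilex_image[OF inj _ _ vr, of U T] clq inj_on_eq_iff[OF injX that]
      by (simp add: clique_order_def)
  qed
  have SX: "S \<subseteq> ?X" if "S \<in> univ (clique_algebra G)" for S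
    using that by (auto simp: univ_clique_algebra determined_def)
  show "embedding ordered_ba_language (clique_algebra G) (clique_algebra G) h"
  proof (rule ba_embeddingI)
    fix S assume S: "S \<in> univ (clique_algebra G)"
    then obtain F where F: "finite F" "F \<subseteq> ?V" "determined G F S"
      by (auto simp: univ_clique_algebra)
    have mem: "g ` T \<in> h S \<longleftrightarrow> T \<in> S" if "T \<in> ?X" for T
      using that SX[OF S] injX by (auto simp: h_def inj_on_image_mem_iff)
    \<comment> \<open>The support moves along with the set: the image of \<open>F\<close> under
      \<open>g\<close> determines \<open>h S\<close>. Testing images of cliques suffices because of
      \<open>imX\<close>.\<close>
    have "g ` T \<in> h S \<longleftrightarrow> g ` T \<inter> g ` F \<in> h S" if T: "T \<in> ?X" for T
    proof -
      have "g ` T \<inter> g ` F = g ` (T \<inter> F)"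
        using inj_on_image_Int[OF inj, of T F] T XV F by auto
      then show ?thesis
        using mem[OF T] mem[OF clique_Int[OF T]] F(3) T by (simp add: determined_def)
    qed
    then have "\<forall>T \<in> (`) g ` ?X. T \<in> h S \<longleftrightarrow> T \<inter> g ` F \<in> h S" by blast
    moreover have "h S \<subseteq> ?X" using SX[OF S] imX by (auto simp: h_def)
    ultimately have "determined G (g ` F) (h S)"
      unfolding imX determined_def by blast
    moreover have "finite (g ` F)" "g ` F \<subseteq> ?V" using F surj by auto
    ultimately show "h S \<in> univ (clique_algebra G)"
      unfolding univ_clique_algebra by blast
    show "h (compl (clique_algebra G) S) = compl (clique_algebra G) (h S)"
      using inj_on_image_set_diff[OF injX, of ?X S] SX[OF S] imX by (simp add: h_def)
  next
    show "inj_on h (univ (clique_algebra G))"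
      unfolding h_def using SX by (intro inj_on_subset[OF inj_on_image_Pow[OF injX]]) auto
  next
    fix S T assume ST: "S \<in> univ (clique_algebra G)" "T \<in> univ (clique_algebra G)"
    show "h (meet (clique_algebra G) S T) = meet (clique_algebra G) (h S) (h T)"
      using inj_on_image_Int[OF injX SX[OF ST(1)] SX[OF ST(2)]] by (simp add: h_def)
    show "h (join (clique_algebra G) S T) = join (clique_algebra G) (h S) (h T)"
      by (simp add: h_def image_Un)
    show "less_in (clique_algebra G) S T = less_in (clique_algebra G) (h S) (h T)"
      using antilex_image[OF injX SX[OF ST(1)] SX[OF ST(2)] cr] by (simp add: h_def)
  qed (simp_all add: h_def imX)
  fix x assume x: "x \<in> ?V"
  have gm: "g x \<in> g ` T \<longleftrightarrow> x \<in> T" if "T \<in> ?X" for T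
    using inj_on_image_mem_iff[OF inj x] that XV by auto
  have "cliques_containing G (g x) = {T \<in> (`) g ` ?X. g x \<in> T}"
    by (simp add: imX cliques_containing_def)
  also have "\<dots> = h (cliques_containing G x)"
    using gm by (auto simp: h_def cliques_containing_def)
  finally show "h (cliques_containing G x) = cliques_containing G (g x)" by simp
qed

end

section \<open>Ordered graphs\<close>

lemma ordered_graph_closed_under [simp]:
  "closed_under ordered_graph_language M A \<longleftrightarrow> A \<subseteq> univ M"
  by (simp add: closed_under_def ordered_graph_language_def)

lemma ordered_graph_structure [simp]: "is_structure ordered_graph_language M"
  by (simp add: is_structure_def)

lemma ordered_graph_generated: "S \<subseteq> univ M \<Longrightarrow> generated ordered_graph_language M S = S"
  by (rule antisym[OF generated_minimal subset_generated]) simp_all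

lemma ordered_graph_embeddingI:
  assumes "\<And>x. x \<in> univ M \<Longrightarrow> h x \<in> univ N" "inj_on h (univ M)"
    and "\<And>R x y. x \<in> univ M \<Longrightarrow> y \<in> univ M \<Longrightarrow> interp_rel M R [x, y] \<longleftrightarrow> interp_rel N R [h x, h y]"
  shows "embedding ordered_graph_language M N h"
proof (rule embeddingI[OF assms(1,2)])
  fix r xs assume "(r, length xs) \<in> rels ordered_graph_language" "xs \<in> lists (univ M)"
  then show "interp_rel M r xs = interp_rel N r (map h xs)"
    using assms(3) by (auto simp: ordered_graph_language_def numeral_2_eq_2 length_Suc_conv)
qed (auto simp: ordered_graph_language_def)

lemma embedding_binary_rel:
  assumes "embedding L M N h" "(R, 2) \<in> rels L" "x \<in> univ M" "y \<in> univ M"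
  shows "interp_rel M R [x, y] \<longleftrightarrow> interp_rel N R [h x, h y]"
  using embeddingD(4)[OF assms(1), of R "[x, y]"] assms(2-) by (simp add: numeral_2_eq_2)

lemma ordered_graph_rels: "(R, 2) \<in> rels ordered_graph_language"
  by (cases R) (simp_all add: ordered_graph_language_def)

text \<open>Without function symbols a finite set generates only itself, so finitely generated means
  finite; the remaining axioms are universal and pull back along an embedding.\<close>

lemma age_ordered_graph:
  assumes "ordered_graph N"
  shows "age ordered_graph_language N \<subseteq> Collect finite_ordered_graph"
proof
  fix A :: "(unit, rel_sym, nat) struct"
  assume "A \<in> age ordered_graph_language N"
  then obtain k where fg: "finitely_generated ordered_graph_language A"
    and k: "embedding ordered_graph_language A N k"
    by (auto simp: age_def)
  have fin: "finite (univ A)"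
    using fg ordered_graph_generated unfolding finitely_generated_def by metis
  note rel = embedding_binary_rel[OF k ordered_graph_rels]
  note kN = embeddingD(1)[OF k]
  have inj: "k x = k y \<longleftrightarrow> x = y" if "x \<in> univ A" "y \<in> univ A" for x y
    using embeddingD(2)[OF k] that by (simp add: inj_on_eq_iff)
  have "irreflp_on (univ A) (\<lambda>x y. interp_rel A Edge [x, y])"
    using ordered_graph.edge_irrefl[OF assms] kN by (auto simp: irreflp_on_def rel)
  moreover have "symp_on (univ A) (\<lambda>x y. interp_rel A Edge [x, y])"
    using ordered_graph.edge_sym[OF assms] kN by (simp add: symp_on_def rel)
  moreover have "linearly_ordered A"
    unfolding linearly_ordered_def
  proof (intro conjI)
    have lin: "irreflp_on (univ N) (less_in N)" "transp_on (univ N) (less_in N)" "totalp_on (univ N) (less_in N)"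
      using ordered_graph.linear[OF assms] by (simp_all add: linearly_ordered_def)
    show "irreflp_on (univ A) (less_in A)"
      using lin(1) kN by (simp add: irreflp_on_def rel)
    show "transp_on (univ A) (less_in A)"
      by (rule transp_onI) (simp add: rel, rule transp_onD[OF lin(2)], simp_all add: kN)
    show "totalp_on (univ A) (less_in A)"
      using lin(3) kN inj by (simp add: totalp_on_def rel)
  qed
  ultimately show "A \<in> Collect finite_ordered_graph"
    using fin by (simp add: finite_ordered_graph_def)
qed

text \<open>Linearity is a universal condition on three elements, and every triple lies in the image
  of a member of \<open>K\<close>.\<close>

lemma fraisse_limit_linearly_ordered:
  assumes M: "fraisse_limit L K M" and L: "(Less, 2) \<in> rels L"
    and K: "\<And>A. A \<in> K \<Longrightarrow> linearly_ordered A"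
  shows "linearly_ordered M"
proof -
  have "\<not> less_in M x x \<and> (less_in M x y \<longrightarrow> less_in M y z \<longrightarrow> less_in M x z) \<and>
      (x \<noteq> y \<longrightarrow> less_in M x y \<or> less_in M y x)"
    if xyz: "x \<in> univ M" "y \<in> univ M" "z \<in> univ M" for x y z
  proof -
    obtain A k where A: "A \<in> K" and k: "embedding L A M k" and im: "{x, y, z} \<subseteq> k ` univ A"
      using fraisse_limit_member[OF M, of "{x, y, z}"] xyz by auto
    obtain a b c where abc: "a \<in> univ A" "b \<in> univ A" "c \<in> univ A" "x = k a" "y = k b" "z = k c"
      using im by auto
    have lin: "irreflp_on (univ A) (less_in A)" "transp_on (univ A) (less_in A)" "totalp_on (univ A) (less_in A)"
      using K[OF A] by (simp_all add: linearly_ordered_def)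
    note rel = embedding_binary_rel[OF k L, symmetric]
    show ?thesis
      using irreflp_onD[OF lin(1) abc(1)] transp_onD[OF lin(2) abc(1-3)] totalp_onD[OF lin(3) abc(1,2)]
      unfolding abc(4-6) by (auto simp: rel abc(1-3))
  qed
  then show ?thesis
    unfolding linearly_ordered_def irreflp_on_def transp_on_def totalp_on_def by blast
qed

lemma random_ordered_graph_ordered_graph:
  assumes "random_ordered_graph G"
  shows "ordered_graph G"
proof
  have G: "fraisse_limit ordered_graph_language (Collect finite_ordered_graph) G"
    using assms by (simp add: random_ordered_graph_def)
  show "linearly_ordered G"
    by (rule fraisse_limit_linearly_ordered[OF G])
       (auto simp: ordered_graph_rels finite_ordered_graph_def)
  have "\<not> interp_rel G Edge [x, x] \<and> (interp_rel G Edge [x, y] \<longrightarrow> interp_rel G Edge [y, x])"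
    if xy: "x \<in> univ G" "y \<in> univ G" for x y
  proof -
    obtain A :: "(unit, rel_sym, nat) struct" and k where A: "finite_ordered_graph A"
      and k: "embedding ordered_graph_language A G k"
      and im: "{x, y} \<subseteq> k ` univ A"
      using fraisse_limit_member[OF G, of "{x, y}"] xy by auto
    obtain a b where ab: "a \<in> univ A" "b \<in> univ A" "x = k a" "y = k b"
      using im by auto
    note rel = embedding_binary_rel[OF k ordered_graph_rels, symmetric]
    show ?thesis
      using A ab(1,2) unfolding ab(3,4)
      by (auto simp: rel finite_ordered_graph_def irreflp_on_def symp_on_def)
  qed
  then show "irreflp_on (univ G) (\<lambda>x y. interp_rel G Edge [x, y])"
    "symp_on (univ G) (\<lambda>x y. interp_rel G Edge [x, y])"
    unfolding irreflp_on_def symp_on_def by blast+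
qed

text \<open>Equal types make the positionwise map from \<open>xs\<close> to \<open>ys\<close> an
  isomorphism of finite induced substructures, which homogeneity extends to
  \<open>G\<close>.\<close>

lemma ordered_graph_homogeneous_tuples:
  assumes G: "homogeneous ordered_graph_language G"
    and xs: "xs \<in> lists (univ G)" and ys: "ys \<in> lists (univ G)"
    and eq: "qf_type ordered_graph_language G xs = qf_type ordered_graph_language G ys"
  obtains g where "isomorphism ordered_graph_language G G g" "map g xs = ys"
proof -
  let ?L = ordered_graph_language
  have len: "length xs = length ys" by (rule qf_type_length[OF eq])
  \<comment> \<open>Entries of \<open>xs\<close> may repeat; the equalities recorded in the type
    make the value independent of the position picked by \<open>SOME\<close>.\<close>
  define s where "s x = ys ! (SOME i. i < length xs \<and> xs ! i = x)" for x
  have s: "s (xs ! i) = ys ! i" if "i < length xs" for i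
  proof -
    have "\<exists>j. j < length xs \<and> xs ! j = xs ! i" using that by blast
    from someI_ex[OF this] show ?thesis
      using qf_type_eqD(1)[OF eq _ that] unfolding s_def by blast
  qed
  have sub: "set xs \<subseteq> univ G" "set ys \<subseteq> univ G" using xs ys by auto
  have map_s: "map s xs = ys" using s len by (simp add: list_eq_iff_nth_eq)
  have im: "s ` set xs = set ys" using map_s by (metis set_map)
  have "embedding ?L (restrict_struct G (set xs)) (restrict_struct G (set ys)) s"
  proof (rule ordered_graph_embeddingI)
    show "inj_on s (univ (restrict_struct G (set xs)))"
      using qf_type_eqD(1)[OF eq] s by (auto simp: inj_on_def in_set_conv_nth)
    fix R x y
    assume "x \<in> univ (restrict_struct G (set xs))" "y \<in> univ (restrict_struct G (set xs))"
    then obtain i j where "i < length xs" "x = xs ! i" "j < length xs" "y = xs ! j"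
      by (auto simp: in_set_conv_nth)
    then show "interp_rel (restrict_struct G (set xs)) R [x, y] \<longleftrightarrow>
        interp_rel (restrict_struct G (set ys)) R [s x, s y]"
      using qf_type_eqD(2)[OF eq _ _ ordered_graph_rels] s by simp
  qed (use im in auto)
  then have iso: "isomorphism ?L (restrict_struct G (set xs)) (restrict_struct G (set ys)) s"
    by (simp add: isomorphism_def im)
  have fg: "finitely_generated ?L (restrict_struct G (set zs))" if "set zs \<subseteq> univ G" for zs
    using finitely_generated_restrict[of ?L G "set zs"] that by (simp add: ordered_graph_generated)
  obtain g where g: "isomorphism ?L G G g" "\<forall>x \<in> set xs. g x = s x"
    using homogeneousD[OF G _ fg[OF sub(1)] _ fg[OF sub(2)] iso] sub by auto
  have "map g xs = ys" using g(2) map_s by (metis map_cong)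
  then show ?thesis using g(1) that by blast
qed

section \<open>The graph on a Boolean algebra\<close>

text \<open>Edges join distinct elements only, since otherwise every nonzero element would carry a
  loop. Both relations are quantifier-free definable in \<open>B\<close>.\<close>

definition meet_graph :: "(ba_sym, rel_sym, 'a) struct \<Rightarrow> (unit, rel_sym, 'a) struct" where
  "meet_graph B = \<lparr>univ = univ B, interp_fun = undefined,
     interp_rel = (\<lambda>R xs. case R of
         Edge \<Rightarrow> xs ! 0 \<noteq> xs ! 1 \<and> meet B (xs ! 0) (xs ! 1) \<noteq> zero B
       | Less \<Rightarrow> less_in B (xs ! 0) (xs ! 1))\<rparr>"

lemma meet_graph_simps [simp]:
  "univ (meet_graph B) = univ B"
  "interp_rel (meet_graph B) Edge [x, y] \<longleftrightarrow> x \<noteq> y \<and> meet B x y \<noteq> zero B"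
  "less_in (meet_graph B) x y = less_in B x y"
  by (simp_all add: meet_graph_def)

lemma ordered_atomless_ba_linear:
  assumes "ordered_atomless_ba B"
  shows "linearly_ordered B"
  using assms unfolding ordered_atomless_ba_def
  by (rule fraisse_limit_linearly_ordered)
     (auto simp: ordered_ba_language_def finite_naturally_ordered_ba_linear)

text \<open>Needed for the symmetry of the edges. As \<open>B\<close> is given only as a limit, the
  law is read off in a finite algebra whose image contains \<open>x\<close> and
  \<open>y\<close>.\<close>

lemma ordered_atomless_ba_meet_commute:
  assumes B: "ordered_atomless_ba B" and xy: "x \<in> univ B" "y \<in> univ B"
  shows "meet B x y = meet B y x"
proof -
  obtain A :: "(ba_sym, rel_sym, nat) struct" and k where A: "finite_naturally_ordered_ba A"
    and k: "embedding ordered_ba_language A B k" and im: "{x, y} \<subseteq> k ` univ A"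
    using fraisse_limit_member[OF B[unfolded ordered_atomless_ba_def], of "{x, y}"] xy by auto
  obtain a b where ab: "a \<in> univ A" "b \<in> univ A" "x = k a" "y = k b"
    using im by auto
  have "meet A a b = meet A b a"
    using A ba_axioms(1)[of A a b] ab by (simp add: finite_naturally_ordered_ba_def)
  then show ?thesis
    using ba_embeddingD(1)[OF k ab(1,2)] ba_embeddingD(1)[OF k ab(2,1)] ab by simp
qed

lemma ordered_graph_meet_graph:
  assumes B: "ordered_atomless_ba B"
  shows "ordered_graph (meet_graph B)"
proof
  show "irreflp_on (univ (meet_graph B)) (\<lambda>x y. interp_rel (meet_graph B) Edge [x, y])"
    by (simp add: irreflp_on_def)
  show "symp_on (univ (meet_graph B)) (\<lambda>x y. interp_rel (meet_graph B) Edge [x, y])"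
    using ordered_atomless_ba_meet_commute[OF B] by (auto simp: symp_on_def)
  show "linearly_ordered (meet_graph B)"
    using ordered_atomless_ba_linear[OF B] by (simp add: linearly_ordered_def)
qed

text \<open>Adjacency amounts to two negated equations between terms of the algebra, so the type in
  \<open>B\<close> decides it.\<close>

lemma meet_graph_qf_type:
  assumes eq: "qf_type ordered_ba_language B xs = qf_type ordered_ba_language B ys"
  shows "qf_type ordered_graph_language (meet_graph B) xs = qf_type ordered_graph_language (meet_graph B) ys"
proof (rule ordered_graph_qf_type_eqI)
  show "length xs = length ys" by (rule qf_type_length[OF eq])
  fix i j assume ij: "i < length xs" "j < length xs"
  show "xs ! i = xs ! j \<longleftrightarrow> ys ! i = ys ! j" by (rule qf_type_eqD(1)[OF eq ij])
  have "meet B (xs ! i) (xs ! j) = zero B \<longleftrightarrow> meet B (ys ! i) (ys ! j) = zero B"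
    using qf_type_satisfies[OF eq, of "Equal (App Meet [Var i, Var j]) (App Zero [])"] ij
    by (simp add: ordered_ba_language_def numeral_2_eq_2)
  then show "interp_rel (meet_graph B) R [xs ! i, xs ! j] \<longleftrightarrow> interp_rel (meet_graph B) R [ys ! i, ys ! j]" for R
    using qf_type_eqD[OF eq ij] by (cases R) (simp_all add: ordered_ba_language_def)
qed

section \<open>The two maps and their composite\<close>

theorem theorem1:
  fixes G :: "(unit, rel_sym, 'g) struct" and B :: "(ba_sym, rel_sym, 'b) struct"
  assumes "random_ordered_graph G" and "ordered_atomless_ba B"
  shows "semi_retract ordered_graph_language G ordered_ba_language B \<and>
    (\<exists>\<phi> \<psi>. semi_retraction ordered_graph_language G ordered_ba_language B \<phi> \<psi> \<and>
       strictly_increasing G B \<phi> \<and> strictly_increasing B G \<psi>)"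
proof -
  let ?GL = ordered_graph_language and ?BL = ordered_ba_language
  let ?C = "clique_algebra G" and ?c = "cliques_containing G"
  interpret ordered_graph G by (rule random_ordered_graph_ordered_graph[OF assms(1)])
  have G: "countable (univ G)" "homogeneous ?GL G" "age ?GL G = Collect finite_ordered_graph"
    using assms(1) by (auto simp: random_ordered_graph_def fraisse_limit_def)
  have B: "countable (univ B)" "homogeneous ?BL B" "age ?BL B = Collect finite_naturally_ordered_ba"
    using assms(2) by (auto simp: ordered_atomless_ba_def fraisse_limit_def)
  obtain e where e: "embedding ?BL ?C B e"
    using homogeneous_universal[OF clique_algebra_structure countable_clique_algebra[OF G(1)] _ B(2)]
      age_clique_algebra B(3) by auto
  obtain \<psi> where \<psi>: "embedding ?GL (meet_graph B) G \<psi>"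
    using homogeneous_universal[of ?GL "meet_graph B" G]
      age_ordered_graph[OF ordered_graph_meet_graph[OF assms(2)]] B(1) G(2,3) by auto
  define \<phi> where "\<phi> = e \<circ> ?c"
  have \<phi>B: "\<phi> x \<in> univ B" if "x \<in> univ G" for x
    using embeddingD(1)[OF e cliques_containing_in_univ[OF that]] by (simp add: \<phi>_def)
  have \<phi>_less: "less_in B (\<phi> x) (\<phi> y)" if "x \<in> univ G" "y \<in> univ G" "less_in G x y" for x y
    using ba_embeddingD(6)[OF e cliques_containing_in_univ[OF that(1)] cliques_containing_in_univ[OF that(2)]]
      cliques_containing_less[OF that] by (simp add: \<phi>_def)
  have linG: "totalp_on (univ G) (less_in G)" and linB: "irreflp_on (univ B) (less_in B)"
      "transp_on (univ B) (less_in B)"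
    using linear ordered_atomless_ba_linear[OF assms(2)] by (auto simp: linearly_ordered_def)
  \<comment> \<open>Distinct vertices are comparable, so strict monotonicity already gives
    injectivity.\<close>
  have \<phi>_inj: "\<phi> x = \<phi> y \<longleftrightarrow> x = y" if "x \<in> univ G" "y \<in> univ G" for x y
    using totalp_onD[OF linG that] \<phi>_less[OF that] \<phi>_less[OF that(2,1)] irreflp_onD[OF linB(1) \<phi>B] that
    by metis
  \<comment> \<open>Reflecting edges and order as well is what makes
    \<open>\<psi> \<circ> \<phi>\<close> an embedding of \<open>G\<close> into itself.\<close>
  have \<phi>: "embedding ?GL G (meet_graph B) \<phi>"
  proof (rule ordered_graph_embeddingI)
    show "inj_on \<phi> (univ G)" using \<phi>_inj by (simp add: inj_on_def)
    fix R x y assume xy: "x \<in> univ G" "y \<in> univ G"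
    show "interp_rel G R [x, y] \<longleftrightarrow> interp_rel (meet_graph B) R [\<phi> x, \<phi> y]"
    proof (cases R)
      case Edge
      show ?thesis
      proof (cases "x = y")
        case True
        then show ?thesis using edge_irrefl xy Edge by (simp add: irreflp_on_def)
      next
        case False
        note c = xy[THEN cliques_containing_in_univ]
        have "?c x \<inter> ?c y \<in> univ ?C" "{} \<in> univ ?C"
          using ba_closed(1)[OF clique_algebra_structure c] ba_closed(4)[OF clique_algebra_structure]
          by simp_all
        then have "e (?c x \<inter> ?c y) = e {} \<longleftrightarrow> ?c x \<inter> ?c y = {}"
          using embeddingD(2)[OF e] by (simp add: inj_on_eq_iff)
        moreover have "meet B (\<phi> x) (\<phi> y) = e (?c x \<inter> ?c y)" "zero B = e {}"
          using ba_embeddingD(1)[OF e c] ba_embeddingD(4)[OF e] by (simp_all add: \<phi>_def)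
        ultimately show ?thesis
          using cliques_containing_meet[OF xy False] \<phi>_inj[OF xy] False Edge by simp
      qed
    next
      case Less
      have "less_in G x y" if "less_in B (\<phi> x) (\<phi> y)"
      proof (rule ccontr)
        assume "\<not> less_in G x y"
        then have "x = y \<or> less_in B (\<phi> y) (\<phi> x)"
          using totalp_onD[OF linG xy] \<phi>_less[OF xy(2,1)] by blast
        then have "less_in B (\<phi> x) (\<phi> x)"
          using that transp_onD[OF linB(2) \<phi>B[OF xy(1)] \<phi>B[OF xy(2)] \<phi>B[OF xy(1)]] by blast
        then show False using irreflp_onD[OF linB(1) \<phi>B[OF xy(1)]] by blast
      qed
      then show ?thesis using \<phi>_less[OF xy] Less by auto
    qed
  qed (simp add: \<phi>B)
  have "respects_qf_types ?GL G ?BL B \<phi>"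
    unfolding respects_qf_types_def
  proof (intro conjI ballI impI)
    fix xs ys assume xs: "xs \<in> lists (univ G)" and ys: "ys \<in> lists (univ G)"
      and eq: "qf_type ?GL G xs = qf_type ?GL G ys"
    obtain g where g: "isomorphism ?GL G G g" and gxs: "map g xs = ys"
      by (rule ordered_graph_homogeneous_tuples[OF G(2) xs ys eq])
    note aut = automorphism_clique_algebra[OF g]
    have c: "map ?c zs \<in> lists (univ ?C)" if "zs \<in> lists (univ G)" for zs
      using that cliques_containing_in_univ by auto
    \<comment> \<open>The types are compared inside the clique algebra, where the automorphism acts;
      \<open>e\<close> merely transports the result, so it need not be compatible with
      \<open>g\<close>.\<close>
    have "map ?c ys = map ((`) ((`) g)) (map ?c xs)"
      using aut(2) xs by (auto simp: gxs[symmetric] in_lists_conv_set)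
    then have "qf_type ?BL ?C (map ?c ys) = qf_type ?BL ?C (map ?c xs)"
      using qf_type_embedding[OF aut(1) clique_algebra_structure c[OF xs]] by simp
    then show "qf_type ?BL B (map \<phi> xs) = qf_type ?BL B (map \<phi> ys)"
      using qf_type_embedding[OF e clique_algebra_structure c[OF xs]]
        qf_type_embedding[OF e clique_algebra_structure c[OF ys]] by (simp add: \<phi>_def)
  qed (simp add: \<phi>B)
  moreover have "respects_qf_types ?BL B ?GL G \<psi>"
    unfolding respects_qf_types_def
  proof (intro conjI ballI impI)
    show "\<psi> \<in> univ B \<rightarrow> univ G" using embeddingD(1)[OF \<psi>] by simp
    fix xs ys assume "xs \<in> lists (univ B)" "ys \<in> lists (univ B)"
      "qf_type ?BL B xs = qf_type ?BL B ys"
    then show "qf_type ?GL G (map \<psi> xs) = qf_type ?GL G (map \<psi> ys)"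
      using meet_graph_qf_type qf_type_embedding[OF \<psi> ordered_graph_structure] by simp
  qed
  moreover have "\<forall>xs \<in> lists (univ G). qf_type ?GL G (map (\<psi> \<circ> \<phi>) xs) = qf_type ?GL G xs"
    using qf_type_embedding[OF embedding_comp[OF \<phi> \<psi>] ordered_graph_structure] by blast
  ultimately have "semi_retraction ?GL G ?BL B \<phi> \<psi>"
    by (simp add: semi_retraction_def)
  moreover have "strictly_increasing G B \<phi>"
    using \<phi>_less by (simp add: strictly_increasing_def)
  moreover have "strictly_increasing B G \<psi>"
    using embedding_binary_rel[OF \<psi> ordered_graph_rels, of _ _ Less] by (simp add: strictly_increasing_def)
  ultimately show ?thesis
    unfolding semi_retract_def by blast
qed

end
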